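(* Let $f,g,h\in S=\mathbb{R}[x,y,z]$ be linearly independent forms of the same degree $n$ with no common zero in $\mathbb{P}^2$ (no basepoints), spanning the net $N$, with associated maps $\phi=\phi_N$ and $\phi^*=\phi_N^*$. Let $\Delta$ be a mesh all of whose edge forms lie in $N$, and let $r\ge0$ be an integer. Suppose that $HP(C^r(\phi(\Delta)),d)=ad^2+bd+c$, where $a,b,c$ are constants. Then $HP(C^r(\Delta),d)=Ad^2+Bd+C$, where \begin{align*} A&=a,\\ B&=bn-2\,\frac{n^2-1+c_n(2n)}{n}\,a,\\ C&=(n^2-1+3c_n(2n))\,a-(n^2-1+c_n(2n))\,b+n^2c . \end{align*} Moreover, the postulation number for $\dim C^r_d(\Delta)$ is at most $n(d_0+3)-3$, where $d_0$ is the postulation number for $\dim C^r_d(\phi(\Delta))$. That is, if $\dim C^r_d(\phi(\Delta))=HP(C^r(\phi(\Delta)),d)$ for all $d>d_0$, then $\dim C^r_d(\Delta)=HP(C^r(\Delta),d)$ for all $d>n(d_0+3)-3$.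
   Context: Meshes. A mesh $\Delta$ is a finite cell complex in $\mathbb{R}^2$ whose 1-cells are arcs of irreducible real algebraic curves; its 2-cells, 1-cells, 0-cells are called faces, edges, vertices. It is assumed that each vertex and edge lies in the boundary of some face, that $\Delta$ is connected, and that it is hereditary: for any faces $\sigma,\sigma'$ sharing a vertex $v$ there is a sequence of faces $\sigma=\sigma_0,\dots,\sigma_k=\sigma'$ all containing $v$ with consecutive faces sharing an edge. The support $|\Delta|\subset\mathbb{R}^2$ is assumed contractible, and each connected component of the intersection of two cells is a cell of $\Delta$. $\Delta_2$ is the set of faces and $\Delta_i^\circ$ is the set of $i$-cells lying in the interior of $|\Delta|$. Faces carry the orientation of $\mathbb{R}^2$, and an orientation of each interior edge is fixed. Edge forms. For an interior edge $\tau$ with underlying curve $g_\tau(x,y)=0$, the edge form $G_\tau\in S=\mathbb{R}[x,y,z]$ is the homogenization of $g_\tau$. "Form" means homogeneous polynomial. Spline module. $C^r_d(\Delta)$ is the real vector space of lists $(F_\sigma\mid\sigma\in\Delta_2)$ of forms of degree $d$ in $S$ whose dehomogenizations $F_\sigma(x,y,1)$ define a piecewise polynomial function on $|\Delta|$ that has continuous $r$th order partial derivatives; equivalently, $G_\tau^{r+1}$ divides $F_\sigma-F_{\sigma'}$ whenever the interior edge $\tau$ borders the faces $\sigma,\sigma'$. The spline module is the graded $S$-module $C^r(\Delta)=\bigoplus_d C^r_d(\Delta)$, i.e. the kernel of $S^{\Delta_2}\to\bigoplus_{\tau\in\Delta_1^\circ}S/\langle G_\tau^{r+1}\rangle$ whose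 $\tau$-component is $F_\sigma-F_{\sigma'}$, where $\tau$ is a component of $\sigma\cap\sigma'$ and its orientation agrees with that induced from $\sigma$. Nets. A net $N$ is a three-dimensional real vector space of forms of a common degree $n$, here the span of $f,g,h$. It defines the rational map $\phi_N\colon\mathbb{P}^2\dashrightarrow\mathbb{P}^2$, $\phi_N[x:y:z]=[f:g:h]$, and the pullback ring map $\phi_N^*\colon R=\mathbb{R}[u,v,w]\to S$, $u\mapsto f$, $v\mapsto g$, $w\mapsto h$. "No common zeros in $\mathbb{P}^2$" is understood over the complex numbers, so that $f,g,h$ is a regular sequence in $S$. For each interior edge $\tau$, $\ell_{\phi(\tau)}\in R$ is the linear form with $\phi^*(\ell_{\phi(\tau)})=G_\tau$, and $J(\phi(\tau))=\langle \ell_{\phi(\tau)}^{r+1}\rangle\subset R$. The graded $R$-module $C^r(\phi(\Delta))$ is defined algebraically as $$C^r(\phi(\Delta))=\ker\Bigl(\bigoplus_{\sigma\in\Delta_2}R\ \longrightarrow\ \bigoplus_{\tau\in\Delta_1^\circ}R/J(\phi(\tau))\Bigr),$$ with the map given by the same differences as for $C^r(\Delta)$ (one summand $\phi(\sigma)$ for each face $\sigma$ and one summand $\phi(\tau)$ for each interior edge $\tau$); $C^r_d(\phi(\Delta))$ is its degree-$d$ part. $c_n(j):=\dim_{\mathbb{R}}(S/\langle f,g,h\rangle)_j$, which is the coefficient of $t^j$ in $(1+t+\cdots+t^{n-1})^3$. For a finitely generated graded module $M$ over a polynomial ring over $\mathbb{R}$, the Hilbert function $d\mapsto\dim_{\mathbb{R}}M_d$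 agrees for $d\gg0$ with a polynomial, the Hilbert polynomial $HP(M,d)$. The postulation number of $M$ is the greatest integer at which the Hilbert function and Hilbert polynomial disagree. *)

theory Defs
  imports
    "HOL-Analysis.Analysis"
    "HOL-Analysis.Finite_Function_Topology"
    "HOL-Computational_Algebra.Computational_Algebra"
begin

section \<open>Real polynomials in finitely many variables\<close>

text \<open>
  Real polynomials are finitely supported maps from exponent vectors to coefficients. The ring
  structure is the convolution product of \<^theory>\<open>HOL-Library.Poly_Mapping\<close>, and the real
  vector space structure (used by \<^const>\<open>span\<close> and \<^const>\<open>dim\<close>) is that of
  \<^theory>\<open>HOL-Analysis.Finite_Function_Topology\<close>.
  Both three-variable rings (coordinates $x,y,z$ and $u,v,w$) are \<open>3 mpoly\<close>, with the
  variables indexed by \<open>1, 2, 3 :: 3\<close>, and the ring in $x,y$ is \<open>2 mpoly\<close>.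
\<close>

type_synonym 'v mpoly = "('v \<Rightarrow>\<^sub>0 nat) \<Rightarrow>\<^sub>0 real"

definition mdegree :: "('v::finite \<Rightarrow>\<^sub>0 nat) \<Rightarrow> nat" where
  "mdegree m = (\<Sum>i\<in>UNIV. Poly_Mapping.lookup m i)"

text \<open>The degree is an integer, so that the only form of negative degree is \<open>0\<close>.\<close>

definition form :: "int \<Rightarrow> 'v::finite mpoly \<Rightarrow> bool" where
  "form d p \<longleftrightarrow> (\<forall>m\<in>Poly_Mapping.keys p. int (mdegree m) = d)"

text \<open>
  Evaluation in any commutative real algebra: at real points, at complex points, and (for the
  pullback ring map) at triples of polynomials.
\<close>

definition eval :: "'v::finite mpoly \<Rightarrow> 'a::{real_vector, comm_ring_1} ^ 'v \<Rightarrow> 'a" where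
  "eval p x =
    (\<Sum>m\<in>Poly_Mapping.keys p.
      Poly_Mapping.lookup p m *\<^sub>R (\<Prod>i\<in>UNIV. (x $ i) ^ Poly_Mapping.lookup m i))"

definition homogenize :: "2 mpoly \<Rightarrow> 3 mpoly" where
  "homogenize q =
    (\<Sum>m\<in>Poly_Mapping.keys q. Poly_Mapping.single
        (Poly_Mapping.single 1 (Poly_Mapping.lookup m 1) + Poly_Mapping.single 2 (Poly_Mapping.lookup m 2)
          + Poly_Mapping.single 3 (Max (mdegree ` Poly_Mapping.keys q) - mdegree m))
        (Poly_Mapping.lookup q m))"


section \<open>Meshes\<close>

text \<open>Cells are closed cells; a vertex is a point, its cell is the singleton.\<close>

record mesh_data =
  verts :: "(real ^ 2) set"
  edges :: "(real ^ 2) set set"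
  faces :: "(real ^ 2) set set"

definition cells :: "mesh_data \<Rightarrow> (real ^ 2) set set" where
  "cells \<Delta> = (\<lambda>v. {v}) ` verts \<Delta> \<union> edges \<Delta> \<union> faces \<Delta>"

definition support :: "mesh_data \<Rightarrow> (real ^ 2) set" where
  "support \<Delta> = \<Union> (cells \<Delta>)"

definition on_irreducible_curve :: "2 mpoly \<Rightarrow> (real ^ 2) set \<Rightarrow> bool" where
  "on_irreducible_curve q \<tau> \<longleftrightarrow> irreducible q \<and> (\<forall>p\<in>\<tau>. eval q p = 0)"

text \<open>
  The edges are arcs whose endpoints are vertices and which contain no other vertices, the faces
  are closed topological discs bounded by edges, and the open cells are pairwise disjoint.
  By invariance of domain, the interior and the frontier of a closed disc in the plane are the
  open cell and its boundary circle; the open cell of an edge is the edge without its endpoints.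
\<close>

definition plane_cell_complex :: "mesh_data \<Rightarrow> bool" where
  "plane_cell_complex \<Delta> \<longleftrightarrow>
     finite (verts \<Delta>) \<and> finite (edges \<Delta>) \<and> finite (faces \<Delta>) \<and>
     (\<forall>\<tau>\<in>edges \<Delta>. \<exists>\<gamma>. arc \<gamma> \<and> path_image \<gamma> = \<tau> \<and>
         \<tau> \<inter> verts \<Delta> = {pathstart \<gamma>, pathfinish \<gamma>}) \<and>
     (\<forall>\<sigma>\<in>faces \<Delta>. \<sigma> homeomorphic cball (0 :: real ^ 2) 1 \<and>
         frontier \<sigma> = \<Union> {\<tau> \<in> edges \<Delta>. \<tau> \<subseteq> frontier \<sigma>}) \<and>
     pairwise disjnt
       ((\<lambda>v. {v}) ` verts \<Delta> \<union> (\<lambda>\<tau>. \<tau> - verts \<Delta>) ` edges \<Delta> \<union> interior ` faces \<Delta>)"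

definition hereditary :: "mesh_data \<Rightarrow> bool" where
  "hereditary \<Delta> \<longleftrightarrow>
     (\<forall>v\<in>verts \<Delta>. \<forall>\<sigma>\<in>faces \<Delta>. \<forall>\<sigma>'\<in>faces \<Delta>. v \<in> \<sigma> \<longrightarrow> v \<in> \<sigma>' \<longrightarrow>
        (\<lambda>\<alpha> \<beta>. \<alpha> \<in> faces \<Delta> \<and> \<beta> \<in> faces \<Delta> \<and> v \<in> \<alpha> \<and> v \<in> \<beta> \<and>
               (\<exists>\<tau>\<in>edges \<Delta>. \<tau> \<subseteq> \<alpha> \<inter> \<beta>))\<^sup>*\<^sup>* \<sigma> \<sigma>')"

text \<open>
  Nonemptiness is required separately because \<^const>\<open>contractible\<close> also holds of the empty set.
\<close>

definition mesh :: "mesh_data \<Rightarrow> bool" where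
  "mesh \<Delta> \<longleftrightarrow>
     plane_cell_complex \<Delta> \<and>
     (\<forall>\<tau>\<in>edges \<Delta>. \<exists>q. on_irreducible_curve q \<tau>) \<and>
     (\<forall>v\<in>verts \<Delta>. \<exists>\<sigma>\<in>faces \<Delta>. v \<in> frontier \<sigma>) \<and>
     (\<forall>\<tau>\<in>edges \<Delta>. \<exists>\<sigma>\<in>faces \<Delta>. \<tau> \<subseteq> frontier \<sigma>) \<and>
     connected (support \<Delta>) \<and>
     hereditary \<Delta> \<and>
     support \<Delta> \<noteq> {} \<and> contractible (support \<Delta>) \<and>
     (\<forall>\<kappa>\<in>cells \<Delta>. \<forall>\<kappa>'\<in>cells \<Delta>. components (\<kappa> \<inter> \<kappa>') \<subseteq> cells \<Delta>)"

text \<open>An edge is interior if its open cell lies in the interior of the support; its endpoints may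
  lie on the boundary.\<close>

definition interior_edges :: "mesh_data \<Rightarrow> (real ^ 2) set set" where
  "interior_edges \<Delta> = {\<tau> \<in> edges \<Delta>. \<tau> - verts \<Delta> \<subseteq> interior (support \<Delta>)}"


section \<open>Graded modules of splines\<close>

text \<open>
  The kernel of the map from the free module on the faces to the direct sum, over the interior
  edges \<open>\<tau>\<close>, of the quotients by the principal ideals generated by \<open>a \<tau>\<close>. Elements of the free
  module are finitely supported maps on sets of points whose keys are faces. The orientations
  only affect the sign of a difference, hence not the kernel.
\<close>

definition difference_kernel ::
  "mesh_data \<Rightarrow> ((real ^ 2) set \<Rightarrow> 3 mpoly) \<Rightarrow> ((real ^ 2) set \<Rightarrow>\<^sub>0 3 mpoly) set" where
  "difference_kernel \<Delta> a =
     {F. Poly_Mapping.keys F \<subseteq> faces \<Delta> \<and>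
         (\<forall>\<tau>\<in>interior_edges \<Delta>. \<forall>\<sigma>\<in>faces \<Delta>. \<forall>\<sigma>'\<in>faces \<Delta>.
            \<tau> \<in> components (\<sigma> \<inter> \<sigma>') \<longrightarrow> a \<tau> dvd Poly_Mapping.lookup F \<sigma> - Poly_Mapping.lookup F \<sigma>')}"

text \<open>In the following, \<open>q \<tau>\<close> is the equation of the curve underlying \<open>\<tau>\<close>.\<close>

definition spline_module ::
  "nat \<Rightarrow> mesh_data \<Rightarrow> ((real ^ 2) set \<Rightarrow> 2 mpoly) \<Rightarrow> ((real ^ 2) set \<Rightarrow>\<^sub>0 3 mpoly) set" where
  "spline_module r \<Delta> q = difference_kernel \<Delta> (\<lambda>\<tau>. homogenize (q \<tau>) ^ (r + 1))"

definition pullback :: "3 mpoly \<Rightarrow> 3 mpoly \<Rightarrow> 3 mpoly \<Rightarrow> 3 mpoly \<Rightarrow> 3 mpoly" where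
  "pullback f g h p = eval p (vector [f, g, h])"

text \<open>Uniquely determined when \<open>f, g, h\<close> are linearly independent and \<open>G\<close> lies in their span.\<close>

definition line_of :: "3 mpoly \<Rightarrow> 3 mpoly \<Rightarrow> 3 mpoly \<Rightarrow> 3 mpoly \<Rightarrow> 3 mpoly" where
  "line_of f g h G = (THE l. form 1 l \<and> pullback f g h l = G)"

definition image_spline_module ::
  "3 mpoly \<Rightarrow> 3 mpoly \<Rightarrow> 3 mpoly \<Rightarrow> nat \<Rightarrow> mesh_data \<Rightarrow> ((real ^ 2) set \<Rightarrow> 2 mpoly)
    \<Rightarrow> ((real ^ 2) set \<Rightarrow>\<^sub>0 3 mpoly) set" where
  "image_spline_module f g h r \<Delta> q =
     difference_kernel \<Delta> (\<lambda>\<tau>. line_of f g h (homogenize (q \<tau>)) ^ (r + 1))"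


section \<open>Hilbert functions\<close>

definition graded_part :: "('k \<Rightarrow>\<^sub>0 3 mpoly) set \<Rightarrow> int \<Rightarrow> ('k \<Rightarrow>\<^sub>0 3 mpoly) set" where
  "graded_part M d = {F \<in> M. \<forall>k. form d (Poly_Mapping.lookup F k)}"

definition hilbert_function :: "('k \<Rightarrow>\<^sub>0 3 mpoly) set \<Rightarrow> int \<Rightarrow> nat" where
  "hilbert_function M d = dim (graded_part M d)"

definition has_hilbert_poly :: "('k \<Rightarrow>\<^sub>0 3 mpoly) set \<Rightarrow> real poly \<Rightarrow> bool" where
  "has_hilbert_poly M P \<longleftrightarrow>
     (\<forall>\<^sub>F d in at_top. real (hilbert_function M d) = poly P (of_int d))"

definition hilbert_poly :: "('k \<Rightarrow>\<^sub>0 3 mpoly) set \<Rightarrow> real poly" where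
  "hilbert_poly M = (THE P. has_hilbert_poly M P)"

definition postulation_number :: "('k \<Rightarrow>\<^sub>0 3 mpoly) set \<Rightarrow> int" where
  "postulation_number M =
     (GREATEST d. real (hilbert_function M d) \<noteq> poly (hilbert_poly M) (of_int d))"

definition ideal3 :: "3 mpoly \<Rightarrow> 3 mpoly \<Rightarrow> 3 mpoly \<Rightarrow> 3 mpoly set" where
  "ideal3 f g h = {p * f + q * g + s * h | p q s. True}"

text \<open>
  The dimension of the degree \<open>j\<close> part of the quotient by the homogeneous ideal generated by
  the forms \<open>f, g, h\<close>, i.e. of the quotient of the space of forms of degree \<open>j\<close> by its subspace
  of those lying in the ideal.
\<close>

definition quotient_dim :: "3 mpoly \<Rightarrow> 3 mpoly \<Rightarrow> 3 mpoly \<Rightarrow> int \<Rightarrow> nat" where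
  "quotient_dim f g h j = dim {p :: 3 mpoly. form j p} - dim {p \<in> ideal3 f g h. form j p}"

end

theory Submission
  imports Defs
begin

text \<open>
  If \<open>f, g, h\<close> have no common zero in the complex projective plane, the ideal they generate contains
  powers of the three variables by the Nullstellensatz, so the Koszul complex of \<open>f, g, h\<close> is acyclic.
  Hence the polynomial ring \<open>S\<close> is free over \<open>R\<close> (acting through the pullback) on lifts of a
  homogeneous basis of \<open>S/(f, g, h)\<close>. Expanding splines in this basis identifies the splines on the mesh
  with tuples of elements of the image spline module, one for each basis element, so the Hilbert function
  of the former is the convolution of the Hilbert function of the latter with \<open>c\<^sub>n\<close>. The same
  identity for \<open>S\<close> over \<open>R\<close> determines \<open>c\<^sub>n\<close> as a third difference with step \<open>n\<close>. In a fixed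
  residue class of degrees modulo \<open>n\<close> only three basis degrees occur, and the formulas follow.
\<close>

text \<open>The spline conditions are compatible with the expansion because every edge form is the
  image under the pullback of a linear form: multiplying a polynomial by \<open>\<phi> p\<close>
  multiplies each of its coordinates by \<open>p\<close>, so divisibility by
  \<open>\<phi> (l ^ (r + 1))\<close> can be tested coordinate by coordinate. The Koszul argument
  passes through powers of the variables because their regularity can be read off from exponents. To
  obtain these powers, setting one variable equal to 1 turns the absence of complex projective zeros
  into an empty affine zero set, and real parts of coefficients make the resulting complex
  certificate real. The bound n(d0 + 3) - 3 reflects that S/(f, g, h) vanishes above degree 3n - 3:
  if a spline has degree d > n d0 + 3n - 3, the coefficient of every basis element has degree
  greater than d0, where the Hilbert function of the image module already equals its
  polynomial.\<close>

abbreviation "lookup \<equiv> Poly_Mapping.lookup"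
abbreviation "keys \<equiv> Poly_Mapping.keys"
abbreviation "single \<equiv> Poly_Mapping.single"

subsection \<open>Polynomials as finitely supported maps\<close>

lemma lookup_scaleR [simp]: "lookup (c *\<^sub>R p) k = c *\<^sub>R lookup p k"
  unfolding scaleR_poly_mapping_def
  by (subst lookup_Abs_poly_mapping) (auto intro: finite_subset[OF _ finite_lookup[of p]])

lemma lookup_single_times:
  fixes p :: "'a::cancel_comm_monoid_add \<Rightarrow>\<^sub>0 'b::semiring_0"
  shows "lookup (single a c * p) (a + k) = c * lookup p k"
proof -
  have *: "(lookup p q when a + k = a + q) = (lookup p q when q = k)" for q
    by (auto simp: when_def)
  have "lookup (single a c * p) (a + k) = Sum_any (\<lambda>l. (c * Sum_any (\<lambda>q. lookup p q when a + k = a + q)) when l = a)"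
    unfolding lookup_mult by (rule arg_cong[of _ _ Sum_any]) (auto simp: fun_eq_iff lookup_single when_def)
  then show ?thesis by (simp add: * cong del: when_cong)
qed

lemma lookup_single_times_other:
  fixes p :: "'a::cancel_comm_monoid_add \<Rightarrow>\<^sub>0 'b::semiring_0"
  assumes "\<And>l. k \<noteq> a + l"
  shows "lookup (single a c * p) k = 0"
proof (rule ccontr)
  assume "lookup (single a c * p) k \<noteq> 0"
  then have "k \<in> keys (single a c * p)" by (simp add: in_keys_iff)
  then show False using keys_mult[of "single a c" p] assms by (auto split: if_splits)
qed

lemma scaleR_eq_single_times:
  fixes p :: "'a::cancel_comm_monoid_add \<Rightarrow>\<^sub>0 'b::real_algebra_1"
  shows "c *\<^sub>R p = single 0 (of_real c) * p"
proof (rule poly_mapping_eqI)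
  fix k
  show "lookup (c *\<^sub>R p) k = lookup (single 0 (of_real c) * p) k"
    using lookup_single_times[of 0 "of_real c" p k] by (simp add: scaleR_conv_of_real)
qed

text \<open>With this structure \<open>eval\<close> is multiplicative for polynomial arguments. Both
  coefficient fields are covered, as the pullback takes values in real polynomials and
  \<open>complexify\<close> in complex ones.\<close>

instance poly_mapping :: (cancel_comm_monoid_add, "{real_algebra_1, comm_ring_1}") real_algebra_1
proof
  fix c :: real and p q :: "'a \<Rightarrow>\<^sub>0 'b"
  show "c *\<^sub>R p * q = c *\<^sub>R (p * q)"
    by (simp add: scaleR_eq_single_times mult.assoc)
  show "p * c *\<^sub>R q = c *\<^sub>R (p * q)"
    by (simp add: scaleR_eq_single_times mult.left_commute)
qed

lemma poly_mapping_sum_single: "p = (\<Sum>m\<in>keys p. single m (lookup p m))"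
proof (rule poly_mapping_eqI)
  fix k
  have "(\<Sum>m\<in>keys p. lookup p m when m = k) = (\<Sum>m\<in>keys p. if m = k then lookup p m else 0)"
    by (simp add: when_def)
  also have "\<dots> = lookup p k"
    by (simp add: sum.delta' not_in_keys_iff_lookup_eq_zero)
  finally show "lookup p k = lookup (\<Sum>m\<in>keys p. single m (lookup p m)) k"
    by (simp add: lookup_sum lookup_single)
qed

lemma poly_mapping_single_induct [case_names zero single add]:
  fixes p :: "'a \<Rightarrow>\<^sub>0 'b::comm_monoid_add"
  assumes "P 0" "\<And>m c. P (single m c)" "\<And>p q. P p \<Longrightarrow> P q \<Longrightarrow> P (p + q)"
  shows "P p"
proof -
  have "P (\<Sum>m\<in>A. single m (lookup p m))" if "finite A" for A
    using that by induction (auto intro: assms)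
  then show ?thesis
    by (metis finite_keys poly_mapping_sum_single)
qed

lemma single_scaleR: "single m (c::real) = c *\<^sub>R single m 1"
  by (rule poly_mapping_eqI) (simp add: lookup_single when_def)

subsection \<open>Evaluation\<close>

lemma eval_superset:
  assumes "finite A" "keys p \<subseteq> A"
  shows "eval p x = (\<Sum>m\<in>A. lookup p m *\<^sub>R (\<Prod>i\<in>UNIV. (x $ i) ^ lookup m i))"
  unfolding eval_def
  using assms by (intro sum.mono_neutral_left) (auto simp: in_keys_iff)

lemma eval_0 [simp]: "eval 0 x = 0"
  by (simp add: eval_def)

lemma eval_add: "eval (p + q) x = eval p x + eval q x"
proof -
  let ?A = "keys p \<union> keys q"
  have "finite ?A" "keys p \<subseteq> ?A" "keys q \<subseteq> ?A" "keys (p + q) \<subseteq> ?A"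
    using keys_add[of p q] by auto
  then show ?thesis
    by (simp add: eval_superset[of ?A] lookup_add scaleR_left_distrib sum.distrib del: finite_Un)
qed

lemma eval_single: "eval (single m c) x = c *\<^sub>R (\<Prod>i\<in>UNIV. (x $ i) ^ lookup m i)"
  by (subst eval_superset[of "{m}"]) (auto split: if_splits)

lemma eval_scaleR: "eval (c *\<^sub>R p) x = c *\<^sub>R eval p x"
proof -
  have "keys (c *\<^sub>R p) \<subseteq> keys p" by (auto simp: in_keys_iff)
  then show ?thesis
    by (subst eval_superset[of "keys p" "c *\<^sub>R p"]) (auto simp: eval_def scaleR_sum_right)
qed

lemma eval_uminus: "eval (- p) x = - eval p x"
  using eval_scaleR[of "-1" p x] by simp

lemma eval_diff: "eval (p - q) x = eval p x - eval q x"
  using eval_add[of p "- q" x] by (simp add: eval_uminus)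

lemma eval_sum: "eval (sum F A) x = (\<Sum>a\<in>A. eval (F a) x)"
  by (induction A rule: infinite_finite_induct) (auto simp: eval_add)

lemma eval_1 [simp]: "eval 1 (x :: 'a::{real_algebra_1, comm_ring_1} ^ 'v::finite) = 1"
  using eval_single[of 0 1 x] by simp

lemma eval_mult:
  fixes x :: "'a::{real_algebra_1, comm_ring_1} ^ 'v::finite"
  shows "eval (p * q) x = eval p x * eval q x"
proof (induction p rule: poly_mapping_single_induct)
  case (single m c)
  show ?case
  proof (induction q rule: poly_mapping_single_induct)
    case (single m' c')
    then show ?case
      by (simp add: mult_single eval_single lookup_add power_add prod.distrib)
  qed (simp_all add: eval_add distrib_left)
qed (simp_all add: eval_add distrib_right)

lemma eval_power:
  fixes x :: "'a::{real_algebra_1, comm_ring_1} ^ 'v::finite"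
  shows "eval (p ^ k) x = eval p x ^ k"
  by (induction k) (auto simp: eval_mult)

subsection \<open>Homogeneous components\<close>

lemma mdegree_add: "mdegree (m + m') = mdegree m + mdegree m'"
  by (simp add: mdegree_def lookup_add sum.distrib)

lemma mdegree_0 [simp]: "mdegree 0 = 0"
  by (simp add: mdegree_def)

lemma form_iff: "form d p \<longleftrightarrow> (\<forall>m. lookup p m \<noteq> 0 \<longrightarrow> int (mdegree m) = d)"
  by (auto simp: form_def in_keys_iff)

lemma form_0 [simp]: "form d 0"
  by (simp add: form_iff)

lemma form_add: "form d p \<Longrightarrow> form d q \<Longrightarrow> form d (p + q)"
  by (auto simp: form_iff lookup_add) (metis add.right_neutral)

lemma form_scaleR: "form d p \<Longrightarrow> form d (c *\<^sub>R p)"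
  by (auto simp: form_iff)

lemma form_uminus: "form d p \<Longrightarrow> form d (- p)"
  by (auto simp: form_iff)

lemma form_diff: "form d p \<Longrightarrow> form d q \<Longrightarrow> form d (p - q)"
  using form_add[of d p "- q"] form_uminus by auto

lemma form_sum: "(\<And>a. a \<in> A \<Longrightarrow> form d (F a)) \<Longrightarrow> form d (sum F A)"
  by (induction A rule: infinite_finite_induct) (auto intro: form_add)

lemma form_single: "form d (single m c) \<longleftrightarrow> c = 0 \<or> int (mdegree m) = d"
  by (auto simp: form_def)

lemma form_mult: "form d p \<Longrightarrow> form e q \<Longrightarrow> form (d + e) (p * q)"
  using keys_mult[of p q] unfolding form_def by (force simp: mdegree_add)

lemma form_1: "form 0 1"
  by (simp add: form_def)

lemma form_power: "form d p \<Longrightarrow> form (int k * d) (p ^ k)"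
  by (induction k) (auto simp: form_1 distrib_right intro: form_mult)

lemma form_neg: "form d p \<Longrightarrow> d < 0 \<Longrightarrow> p = 0"
  by (intro poly_mapping_eqI) (force simp: form_iff)

lemma subspace_form: "subspace {p. form d p}"
  by (auto simp: subspace_def form_add form_scaleR)

definition hcomp :: "int \<Rightarrow> 'v::finite mpoly \<Rightarrow> 'v mpoly" where
  "hcomp d p = (\<Sum>m | m \<in> keys p \<and> int (mdegree m) = d. single m (lookup p m))"

lemma lookup_hcomp: "lookup (hcomp d p) m = (if int (mdegree m) = d then lookup p m else 0)"
proof -
  have "lookup (hcomp d p) m = (\<Sum>k | k \<in> keys p \<and> int (mdegree k) = d. if k = m then lookup p k else 0)"
    by (simp add: hcomp_def lookup_sum lookup_single when_def)
  also have "\<dots> = (if int (mdegree m) = d then lookup p m else 0)"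
    by (subst sum.delta) (auto simp: not_in_keys_iff_lookup_eq_zero)
  finally show ?thesis .
qed

lemma form_hcomp: "form d (hcomp d p)"
  by (simp add: form_iff lookup_hcomp)

lemma hcomp_form: "form d p \<Longrightarrow> hcomp e p = (if d = e then p else 0)"
  by (intro poly_mapping_eqI) (auto simp: form_iff lookup_hcomp)

lemma hcomp_add: "hcomp d (p + q) = hcomp d p + hcomp d q"
  by (intro poly_mapping_eqI) (auto simp: lookup_hcomp lookup_add)

lemma hcomp_diff: "hcomp d (p - q) = hcomp d p - hcomp d q"
  by (intro poly_mapping_eqI) (auto simp: lookup_hcomp lookup_minus)

lemma hcomp_0 [simp]: "hcomp d 0 = 0"
  by (intro poly_mapping_eqI) (auto simp: lookup_hcomp)

text \<open>Lets the cofactors in a homogeneous identity be replaced by their components of the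
  right degree.\<close>

lemma hcomp_mult_form:
  assumes "form e q"
  shows "hcomp d (p * q) = hcomp (d - e) p * q"
proof (induction p rule: poly_mapping_single_induct)
  case (single m c)
  have "form (int (mdegree m) + e) (single m c * q)" "form (int (mdegree m)) (single m c)"
    by (auto simp: form_single intro!: form_mult assms)
  then show ?case
    by (simp add: hcomp_form algebra_simps)
qed (simp_all add: hcomp_add distrib_right)

lemma hcomp_eventually_0: "\<exists>K. \<forall>k\<ge>K. hcomp (int k) p = 0"
proof -
  let ?K = "Suc (Max (insert 0 (mdegree ` keys p)))"
  have "hcomp (int k) p = 0" if "k \<ge> ?K" for k
  proof (rule poly_mapping_eqI)
    fix m
    have "m \<in> keys p \<longrightarrow> mdegree m < ?K"
      by (simp add: less_Suc_eq_le)
    then show "lookup (hcomp (int k) p) m = lookup 0 m"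
      using \<open>k \<ge> ?K\<close> by (auto simp: lookup_hcomp in_keys_iff)
  qed
  then show ?thesis by blast
qed

subsection \<open>Complex points of proper ideals\<close>

lemma finite_mdegree_le: "finite {m :: 'v::finite \<Rightarrow>\<^sub>0 nat. mdegree m \<le> d}"
proof (rule inj_on_finite[where f = lookup and B = "UNIV \<rightarrow>\<^sub>E {..d}"])
  show "lookup ` {m :: 'v \<Rightarrow>\<^sub>0 nat. mdegree m \<le> d} \<subseteq> UNIV \<rightarrow>\<^sub>E {..d}"
  proof -
    have "lookup m i \<le> mdegree m" for m :: "'v \<Rightarrow>\<^sub>0 nat" and i
      unfolding mdegree_def by (rule member_le_sum) auto
    then show ?thesis by (auto intro: order_trans)
  qed
qed (auto intro!: inj_onI finite_PiE poly_mapping_eqI)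

abbreviation cconst :: "complex \<Rightarrow> ('v \<Rightarrow>\<^sub>0 nat) \<Rightarrow>\<^sub>0 complex" where
  "cconst \<equiv> single 0"

definition pvar :: "'v \<Rightarrow> ('v \<Rightarrow>\<^sub>0 nat) \<Rightarrow>\<^sub>0 'b::zero_neq_one" where
  "pvar i = single (single i 1) 1"

text \<open>The scaling that comes with the type is by real numbers; the counting argument below
  needs linear dependence over the complex numbers.\<close>

interpretation cpoly: vector_space "\<lambda>c (p :: ('v \<Rightarrow>\<^sub>0 nat) \<Rightarrow>\<^sub>0 complex). cconst c * p"
  by unfold_locales (auto simp: distrib_left distrib_right single_add mult.assoc[symmetric] mult_single)

text \<open>The polynomials have countable dimension over the uncountable field \<open>\<complex>\<close>.\<close>

lemma complex_family_dependent:
  fixes u :: "complex \<Rightarrow> ('v::finite \<Rightarrow>\<^sub>0 nat) \<Rightarrow>\<^sub>0 complex"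
  obtains L c where "finite L" "\<exists>\<zeta>\<in>L. c \<zeta> \<noteq> 0" "(\<Sum>\<zeta>\<in>L. cconst (c \<zeta>) * u \<zeta>) = 0"
proof (cases "inj u")
  case False
  then obtain a b where ab: "a \<noteq> b" "u a = u b" by (auto simp: inj_def)
  let ?c = "\<lambda>x. if x = a then 1 else - 1 :: complex"
  have "(\<Sum>\<zeta>\<in>{a, b}. cconst (?c \<zeta>) * u \<zeta>) = 0"
    using ab by (simp add: single_uminus)
  then show ?thesis by (intro that[of "{a, b}" ?c]) auto
next
  case True
  define U where "U d = {\<zeta>. keys (u \<zeta>) \<subseteq> {m. mdegree m \<le> d}}" for d
  have "\<exists>d. \<zeta> \<in> U d" for \<zeta>
    unfolding U_def by (rule exI[of _ "Max (insert 0 (mdegree ` keys (u \<zeta>)))"]) auto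
  then have "(\<Union>d. U d) = UNIV" by auto
  \<comment> \<open>If every \<open>U d\<close> were finite, the complex numbers would be a
    countable union of finite sets.\<close>
  then have "\<exists>d. infinite (U d)"
    by (metis uncountable_UNIV_complex countableI_type countable_UN countable_finite)
  then obtain d where d: "infinite (U d)" ..
  define M where "M = {m :: 'v \<Rightarrow>\<^sub>0 nat. mdegree m \<le> d}"
  define B where "B = (\<lambda>m. single m (1::complex)) ` M"
  have finB: "finite B"
    by (simp add: B_def M_def finite_mdegree_le)
  \<comment> \<open>One more index than there are monomials of degree at most \<open>d\<close>
    forces a linear relation among the \<open>u \<zeta>\<close>.\<close>
  obtain L where L: "L \<subseteq> U d" "finite L" "card L = Suc (card B)"
    using d infinite_arbitrarily_large by blast
  have sp: "u ` L \<subseteq> cpoly.span B"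
  proof clarify
    fix \<zeta> assume "\<zeta> \<in> L"
    then have M: "keys (u \<zeta>) \<subseteq> M" using L by (auto simp: U_def M_def)
    have "(\<Sum>m\<in>keys (u \<zeta>). cconst (lookup (u \<zeta>) m) * single m 1) \<in> cpoly.span B"
      using M by (intro cpoly.span_sum cpoly.span_scale cpoly.span_base) (auto simp: B_def)
    then show "u \<zeta> \<in> cpoly.span B"
      by (simp add: mult_single flip: poly_mapping_sum_single)
  qed
  have card: "card (u ` L) = card L"
    using True by (intro card_image) (auto intro: inj_on_subset)
  have "cpoly.dependent (u ` L)"
    using cpoly.independent_span_bound[OF finB _ sp] card L(3) by auto
  then obtain w where w: "\<exists>v\<in>u ` L. w v \<noteq> 0" "(\<Sum>v\<in>u ` L. cconst (w v) * v) = 0"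
    using cpoly.dependent_finite[of "u ` L"] L(2) by auto
  have "(\<Sum>\<zeta>\<in>L. cconst (w (u \<zeta>)) * u \<zeta>) = 0"
    using w(2) by (subst (asm) sum.reindex) (use True in \<open>auto intro: inj_on_subset\<close>)
  then show ?thesis using w(1) L(2) by (intro that[of L "w \<circ> u"]) auto
qed

definition is_ideal :: "'a::comm_ring_1 set \<Rightarrow> bool" where
  "is_ideal J \<longleftrightarrow> 0 \<in> J \<and> (\<forall>x\<in>J. \<forall>y\<in>J. x + y \<in> J) \<and> (\<forall>a. \<forall>x\<in>J. a * x \<in> J)"

lemma is_idealD:
  assumes "is_ideal J"
  shows "0 \<in> J" "x \<in> J \<Longrightarrow> y \<in> J \<Longrightarrow> x + y \<in> J" "x \<in> J \<Longrightarrow> a * x \<in> J" "x \<in> J \<Longrightarrow> x * a \<in> J"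
    "x \<in> J \<Longrightarrow> y \<in> J \<Longrightarrow> x - y \<in> J"
proof -
  show *: "0 \<in> J" "x \<in> J \<Longrightarrow> y \<in> J \<Longrightarrow> x + y \<in> J" "x \<in> J \<Longrightarrow> a * x \<in> J" for x y a
    using assms by (auto simp: is_ideal_def)
  show "x \<in> J \<Longrightarrow> x * a \<in> J" using *(3)[of x a] by (simp add: mult.commute)
  show "x \<in> J \<Longrightarrow> y \<in> J \<Longrightarrow> x - y \<in> J" using *(2)[of x "-1 * y"] *(3)[of y "-1"] by simp
qed

lemma ideal_sum: "is_ideal J \<Longrightarrow> (\<And>a. a \<in> A \<Longrightarrow> F a \<in> J) \<Longrightarrow> sum F A \<in> J"
  by (induction A rule: infinite_finite_induct) (auto intro: is_idealD)

lemma ideal_cong_mult: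
  assumes "is_ideal J" "a - b \<in> J" "c - d \<in> J"
  shows "a * c - b * d \<in> J"
proof -
  have "(a - b) * c + b * (c - d) \<in> J"
    by (intro is_idealD(2)[OF assms(1)] is_idealD(4)[OF assms(1,2)] is_idealD(3)[OF assms(1,3)])
  then show ?thesis by (simp add: algebra_simps)
qed

lemma ideal_cong_power: "is_ideal J \<Longrightarrow> a - b \<in> J \<Longrightarrow> a ^ k - b ^ k \<in> J"
  by (induction k) (auto intro: is_idealD ideal_cong_mult)

lemma ideal_cong_prod:
  "is_ideal J \<Longrightarrow> (\<And>i. i \<in> A \<Longrightarrow> F i - G i \<in> J) \<Longrightarrow> prod F A - prod G A \<in> J"
  by (induction A rule: infinite_finite_induct) (auto intro: is_idealD ideal_cong_mult)

text \<open>The substitution homomorphism from univariate to multivariate polynomials. It serves to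
  say that \<open>y\<close> is algebraic modulo an ideal.\<close>

definition poly_at :: "'c::comm_semiring_1 poly \<Rightarrow> ('m::comm_monoid_add \<Rightarrow>\<^sub>0 'c) \<Rightarrow> ('m \<Rightarrow>\<^sub>0 'c)" where
  "poly_at p y = poly (map_poly (single 0) p) y"

lemma poly_at_0 [simp]: "poly_at 0 y = 0"
  by (simp add: poly_at_def)

lemma poly_at_pCons: "poly_at (pCons a p) y = single 0 a + y * poly_at p y"
  by (simp add: poly_at_def map_poly_pCons)

lemma poly_at_add: "poly_at (p + q) y = poly_at p y + poly_at q y"
  by (induction p q rule: poly_induct2) (auto simp: poly_at_pCons single_add algebra_simps)

lemma poly_at_smult: "poly_at (smult c p) y = single 0 c * poly_at p y"
  by (induction p) (auto simp: poly_at_pCons mult_single algebra_simps)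

lemma poly_at_mult: "poly_at (p * q) y = poly_at p y * poly_at q y"
  by (induction p) (auto simp: poly_at_pCons poly_at_add poly_at_smult algebra_simps)

lemma poly_at_sum: "poly_at (sum F A) y = (\<Sum>a\<in>A. poly_at (F a) y)"
  by (induction A rule: infinite_finite_induct) (auto simp: poly_at_add)

lemma poly_at_prod: "poly_at (prod F A) y = (\<Prod>a\<in>A. poly_at (F a) y)"
  by (induction A rule: infinite_finite_induct) (auto simp: poly_at_mult poly_at_pCons one_pCons)

text \<open>Over the complex numbers \<open>p\<close> splits into linear factors. Each
  \<open>y - cconst \<zeta>\<close> is invertible modulo \<open>J\<close>, so the factors can be
  cancelled one by one until a nonzero constant remains in \<open>J\<close>.\<close>

lemma ideal_poly_at_invertible:
  fixes y :: "('v::finite \<Rightarrow>\<^sub>0 nat) \<Rightarrow>\<^sub>0 complex"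
  assumes J: "is_ideal J" and u: "\<And>\<zeta>. \<exists>u. u * (y - cconst \<zeta>) - 1 \<in> J"
    and "p \<noteq> 0" "poly_at p y \<in> J"
  shows "1 \<in> J"
  using assms(3,4)
proof (induction "degree p" arbitrary: p)
  case 0
  then obtain c where p: "p = [:c:]" and "c \<noteq> 0" by (metis degree_eq_zeroE pCons_0_0)
  then have "cconst c \<in> J" using 0 by (simp add: poly_at_pCons)
  then have "cconst (1 / c) * cconst c \<in> J" by (rule is_idealD(3)[OF J])
  then show ?case using \<open>c \<noteq> 0\<close> by (simp add: mult_single)
next
  case (Suc k)
  then have "\<not> constant (poly p)" by (simp add: constant_degree)
  then obtain \<zeta> where "poly p \<zeta> = 0"
    using fundamental_theorem_of_algebra by blast
  then obtain q where p: "p = [:-\<zeta>, 1:] * q" by (metis poly_eq_0_iff_dvd dvdE)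
  have q: "q \<noteq> 0" using p Suc by auto
  have dq: "k = degree q"
    using Suc(2) p q by (subst (asm) p, subst (asm) degree_mult_eq) auto
  obtain u where "u * (y - cconst \<zeta>) - 1 \<in> J" using u by blast
  then have "(u * (y - cconst \<zeta>) - 1) * poly_at q y \<in> J" by (rule is_idealD(4)[OF J])
  moreover have "poly_at p y = (y - cconst \<zeta>) * poly_at q y"
    unfolding p poly_at_mult by (simp add: poly_at_pCons single_uminus)
  then have "u * ((y - cconst \<zeta>) * poly_at q y) \<in> J"
    using Suc(4) is_idealD(3)[OF J] by simp
  ultimately have "u * ((y - cconst \<zeta>) * poly_at q y) - (u * (y - cconst \<zeta>) - 1) * poly_at q y \<in> J"
    using is_idealD(5)[OF J] by blast
  then have "poly_at q y \<in> J" by (simp add: algebra_simps)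
  then show ?case using Suc(1) dq q by blast
qed

text \<open>If every \<open>y - cconst \<zeta>\<close> had an inverse \<open>u \<zeta>\<close>
  modulo \<open>J\<close>, a linear relation among finitely many of these inverses would become,
  after clearing denominators, an algebraic equation for \<open>y\<close> modulo \<open>J\<close>,
  and the previous lemma would put 1 into \<open>J\<close>. The conclusion says that
  \<open>y - cconst \<zeta>\<close> can be adjoined to \<open>J\<close> without reaching 1.\<close>

lemma proper_ideal_residue:
  fixes y :: "('v::finite \<Rightarrow>\<^sub>0 nat) \<Rightarrow>\<^sub>0 complex"
  assumes J: "is_ideal J" and "1 \<notin> J"
  shows "\<exists>\<zeta>. \<forall>u. u * (y - cconst \<zeta>) - 1 \<notin> J"
proof (rule ccontr)
  assume "\<not> ?thesis"
  then have inv: "\<exists>u. u * (y - cconst \<zeta>) - 1 \<in> J" for \<zeta> by blast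
  then obtain u where u: "\<And>\<zeta>. u \<zeta> * (y - cconst \<zeta>) - 1 \<in> J" by metis
  obtain L c where L: "finite L" "\<exists>\<zeta>\<in>L. c \<zeta> \<noteq> 0" "(\<Sum>\<zeta>\<in>L. cconst (c \<zeta>) * u \<zeta>) = 0"
    by (rule complex_family_dependent)
  \<comment> \<open>The numerator of the sum of the fractions
    \<open>c \<zeta> / (t - \<zeta>)\<close> over their common denominator. At \<open>a\<close> only
    the term of \<open>a\<close> survives, so it is nonzero.\<close>
  define p where "p = (\<Sum>\<zeta>\<in>L. smult (c \<zeta>) (\<Prod>\<mu>\<in>L - {\<zeta>}. [:- \<mu>, 1:]))"
  obtain a where a: "a \<in> L" "c a \<noteq> 0" using L by blast
  have "poly p a = (\<Sum>\<zeta>\<in>L. c \<zeta> * (\<Prod>\<mu>\<in>L - {\<zeta>}. a - \<mu>))"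
    by (simp add: p_def poly_sum poly_prod)
  also have "\<dots> = c a * (\<Prod>\<mu>\<in>L - {a}. a - \<mu>)"
    using L(1) a by (subst sum.remove[of _ a]) (auto intro!: sum.neutral)
  also have "\<dots> \<noteq> 0" using a L(1) by auto
  finally have "p \<noteq> 0" by auto
  have pr: "poly_at (\<Prod>\<mu>\<in>A. [:- \<mu>, 1:]) y = (\<Prod>\<mu>\<in>A. y - cconst \<mu>)" for A
    by (simp add: poly_at_prod poly_at_pCons single_uminus)
  let ?w = "\<Prod>\<mu>\<in>L. y - cconst \<mu>"
  \<comment> \<open>Subtracting the vanishing relation times \<open>?w\<close> turns every summand
    into a multiple of \<open>u \<zeta> * (y - cconst \<zeta>) - 1\<close>, which lies in
    \<open>J\<close>.\<close>
  have "poly_at p y = poly_at p y - (\<Sum>\<zeta>\<in>L. cconst (c \<zeta>) * u \<zeta>) * ?w"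
    using L(3) by simp
  also have "\<dots> = (\<Sum>\<zeta>\<in>L. cconst (c \<zeta>) * ((\<Prod>\<mu>\<in>L - {\<zeta>}. y - cconst \<mu>) - u \<zeta> * ?w))"
    by (simp add: p_def poly_at_sum poly_at_smult pr sum_distrib_right right_diff_distrib mult.assoc
        flip: sum_subtractf)
  also have "\<dots> = (\<Sum>\<zeta>\<in>L. - (cconst (c \<zeta>) * (\<Prod>\<mu>\<in>L - {\<zeta>}. y - cconst \<mu>)) * (u \<zeta> * (y - cconst \<zeta>) - 1))"
    using L(1) by (intro sum.cong refl) (simp add: prod.remove algebra_simps)
  also have "\<dots> \<in> J" by (intro ideal_sum is_idealD(3) J u)
  finally show False
    using ideal_poly_at_invertible[OF J inv \<open>p \<noteq> 0\<close>] assms(2) by blast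
qed

text \<open>A weak Nullstellensatz without maximal ideals: the previous lemma fixes the value of one
  variable at a time, enlarging the ideal while keeping it proper.\<close>

lemma proper_ideal_point:
  fixes J :: "(('v::finite \<Rightarrow>\<^sub>0 nat) \<Rightarrow>\<^sub>0 complex) set"
  assumes "is_ideal J" "1 \<notin> J"
  obtains x J' where "is_ideal J'" "1 \<notin> J'" "J \<subseteq> J'" "\<And>i. pvar i - cconst (x i) \<in> J'"
proof -
  have "\<exists>x J'. is_ideal J' \<and> 1 \<notin> J' \<and> J \<subseteq> J' \<and> (\<forall>i\<in>A. pvar i - cconst (x i) \<in> J')"
    if "finite A" for A :: "'v set"
    using that
  proof induction
    case empty
    then show ?case using assms by auto
  next
    case (insert j A)
    then obtain x J1 where J1: "is_ideal J1" "1 \<notin> J1" "J \<subseteq> J1"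
      and x: "\<forall>i\<in>A. pvar i - cconst (x i) \<in> J1" by blast
    obtain \<zeta> where \<zeta>: "\<And>u. u * (pvar j - cconst \<zeta>) - 1 \<notin> J1"
      using proper_ideal_residue[OF J1(1,2)] by blast
    define J2 where "J2 = {a + b * (pvar j - cconst \<zeta>) |a b. a \<in> J1}"
    have "is_ideal J2"
      unfolding is_ideal_def
    proof (intro conjI ballI allI)
      show "0 \<in> J2" unfolding J2_def using is_idealD(1)[OF J1(1)] by (force intro: exI[of _ 0])
    next
      fix v w assume "v \<in> J2" "w \<in> J2"
      then obtain a b a' b' where *: "v = a + b * (pvar j - cconst \<zeta>)" "w = a' + b' * (pvar j - cconst \<zeta>)"
        "a \<in> J1" "a' \<in> J1" unfolding J2_def by blast
      have "v + w = (a + a') + (b + b') * (pvar j - cconst \<zeta>)"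
        by (simp add: * algebra_simps)
      then show "v + w \<in> J2" unfolding J2_def using * is_idealD(2)[OF J1(1)] by blast
    next
      fix r v assume "v \<in> J2"
      then obtain a b where *: "v = a + b * (pvar j - cconst \<zeta>)" "a \<in> J1" unfolding J2_def by blast
      have "r * v = r * a + (r * b) * (pvar j - cconst \<zeta>)"
        by (simp add: * algebra_simps)
      then show "r * v \<in> J2" unfolding J2_def using * is_idealD(3)[OF J1(1)] by blast
    qed
    moreover have "1 \<notin> J2"
    proof
      assume "1 \<in> J2"
      then obtain a b where "1 = a + b * (pvar j - cconst \<zeta>)" "a \<in> J1" unfolding J2_def by blast
      then have "(- b) * (pvar j - cconst \<zeta>) + 1 \<in> J1" by (simp add: algebra_simps)
      then have "- 1 * ((- b) * (pvar j - cconst \<zeta>) + 1) \<in> J1" by (rule is_idealD(3)[OF J1(1)])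
      then show False using \<zeta>[of b] by simp
    qed
    moreover have sub: "J1 \<subseteq> J2"
    proof
      fix a assume "a \<in> J1"
      then have "a = a + 0 * (pvar j - cconst \<zeta>) \<and> a \<in> J1" by simp
      then show "a \<in> J2" unfolding J2_def by blast
    qed
    moreover have "pvar j - cconst \<zeta> = 0 + 1 * (pvar j - cconst \<zeta>) \<and> 0 \<in> J1"
      using is_idealD(1)[OF J1(1)] by simp
    then have "pvar j - cconst \<zeta> \<in> J2" unfolding J2_def by blast
    then have "\<forall>i\<in>insert j A. pvar i - cconst ((x(j := \<zeta>)) i) \<in> J2"
      using x sub insert by auto
    ultimately show ?case using J1(3) by blast
  qed
  then show ?thesis using that by (metis finite UNIV_I)
qed

text \<open>Extension of scalars is phrased as evaluation at the tuple of variables, so that the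
  lemmas on \<open>eval\<close> apply to it.\<close>

abbreviation (input) complexify :: "'v::finite mpoly \<Rightarrow> ('v \<Rightarrow>\<^sub>0 nat) \<Rightarrow>\<^sub>0 complex" where
  "complexify p \<equiv> eval p (\<chi> i. pvar i)"

text \<open>Modulo \<open>J\<close> every variable is congruent to a constant, hence
  \<open>complexify p\<close> to the constant \<open>eval p x\<close>; a nonzero constant in
  \<open>J\<close> would put 1 there.\<close>

lemma eval_zero_of_ideal:
  fixes p :: "'v::finite mpoly" and x :: "complex ^ 'v"
  assumes J: "is_ideal J" "1 \<notin> J" and x: "\<And>i. pvar i - cconst (x $ i) \<in> J"
    and p: "complexify p \<in> J"
  shows "eval p x = 0"
proof (rule ccontr)
  assume nz: "eval p x \<noteq> 0"
  have prod: "cconst (\<Prod>i\<in>A. (x $ i) ^ k i) = (\<Prod>i\<in>A. cconst (x $ i) ^ k i)" for A and k :: "'v \<Rightarrow> nat"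
  proof -
    have cc: "cconst (z * w) = cconst z * cconst w" for z w
      by (simp add: mult_single)
    have cp: "cconst (z ^ l) = cconst z ^ l" for z l
      by (induction l) (auto simp: cc)
    then show ?thesis
      by (induction A rule: infinite_finite_induct) (auto simp: cc cp)
  qed
  have "complexify p - cconst (eval p x) \<in> J"
  proof (induction p rule: poly_mapping_single_induct)
    case (single m c)
    have "c *\<^sub>R ((\<Prod>i\<in>UNIV. pvar i ^ lookup m i) - (\<Prod>i\<in>UNIV. cconst (x $ i) ^ lookup m i)) \<in> J"
      unfolding scaleR_eq_single_times
      by (intro is_idealD(3) J(1) ideal_cong_prod ideal_cong_power x)
    then show ?case
      by (simp add: eval_single scaleR_right_diff_distrib)
        (simp add: scaleR_eq_single_times mult_single scaleR_conv_of_real flip: prod)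
  next
    case (add p q)
    then have "(complexify p - cconst (eval p x)) + (complexify q - cconst (eval q x)) \<in> J"
      by (rule is_idealD(2)[OF J(1)])
    then show ?case by (simp add: eval_add single_add algebra_simps)
  qed (simp add: is_idealD[OF J(1)])
  then have "complexify p - (complexify p - cconst (eval p x)) \<in> J"
    using p is_idealD(5)[OF J(1)] by blast
  then have "cconst (1 / eval p x) * cconst (eval p x) \<in> J"
    by (intro is_idealD(3) J(1)) simp
  then show False using J(2) nz by (simp add: mult_single)
qed

lemma complexify_single: "complexify (single m c) = single m (of_real c)"
proof -
  have pw: "pvar i ^ k = (single (single i k) 1 :: ('a \<Rightarrow>\<^sub>0 nat) \<Rightarrow>\<^sub>0 complex)" for i k
  proof (induction k)
    case (Suc k)
    then show ?case by (simp add: pvar_def mult_single flip: single_add)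
  qed simp
  have "(\<Prod>i\<in>A. single (single i (k i)) 1) = (single (\<Sum>i\<in>A. single i (k i)) 1 :: ('a \<Rightarrow>\<^sub>0 nat) \<Rightarrow>\<^sub>0 complex)"
    for A and k :: "'a \<Rightarrow> nat"
    by (induction A rule: infinite_finite_induct) (auto simp: mult_single)
  moreover have "(\<Sum>i\<in>UNIV. single i (lookup m i)) = m"
    by (subst (2) poly_mapping_sum_single, rule sum.mono_neutral_right) (auto simp: in_keys_iff)
  ultimately have "(\<Prod>i\<in>UNIV. pvar i ^ lookup m i) = (single m 1 :: ('a \<Rightarrow>\<^sub>0 nat) \<Rightarrow>\<^sub>0 complex)"
    by (simp add: pw)
  then show ?thesis
    by (simp add: eval_single scaleR_eq_single_times mult_single)
qed

section \<open>Descent from complex to real coefficients\<close>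

definition re_part :: "('m \<Rightarrow>\<^sub>0 complex) \<Rightarrow> ('m \<Rightarrow>\<^sub>0 real)" where
  "re_part p = Poly_Mapping.map Re p"

lemma lookup_re_part: "lookup (re_part p) m = Re (lookup p m)"
  by (simp add: re_part_def map.rep_eq when_def)

lemma re_part_add: "re_part (p + q) = re_part p + re_part q"
  by (intro poly_mapping_eqI) (simp add: lookup_re_part lookup_add)

lemma re_part_0 [simp]: "re_part 0 = 0"
  by (intro poly_mapping_eqI) (simp add: lookup_re_part)

lemma re_part_single: "re_part (single m c) = single m (Re c)"
  by (intro poly_mapping_eqI) (simp add: lookup_re_part lookup_single when_def)

text \<open>Taking real parts is linear over real polynomials, so a complex combination of real
  generators equal to 1 yields a real one.\<close>

lemma re_part_mult_complexify: "re_part (p * complexify q) = re_part p * q"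
proof (induction q rule: poly_mapping_single_induct)
  case (single m c)
  show ?case
  proof (induction p rule: poly_mapping_single_induct)
    case (single m' c')
    then show ?case
      by (simp add: complexify_single mult_single re_part_single)
  qed (auto simp: re_part_add distrib_right)
qed (auto simp: re_part_add distrib_left eval_add)

subsection \<open>The Nullstellensatz for three forms without common zeros\<close>

lemma ideal3_iff: "p \<in> ideal3 f g h \<longleftrightarrow> (\<exists>a b c. p = a * f + b * g + c * h)"
  by (auto simp: ideal3_def)

lemma is_ideal_ideal3: "is_ideal (ideal3 f g h)"
  unfolding is_ideal_def
proof (intro conjI ballI allI)
  show "0 \<in> ideal3 f g h" unfolding ideal3_iff by (intro exI[of _ 0]) simp
next
  fix p q assume "p \<in> ideal3 f g h" "q \<in> ideal3 f g h"
  then obtain a b c a' b' c' where "p = a * f + b * g + c * h" "q = a' * f + b' * g + c' * h"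
    unfolding ideal3_iff by blast
  then have "p + q = (a + a') * f + (b + b') * g + (c + c') * h" by (simp add: algebra_simps)
  then show "p + q \<in> ideal3 f g h" unfolding ideal3_iff by blast
next
  fix r p assume "p \<in> ideal3 f g h"
  then obtain a b c where "p = a * f + b * g + c * h"
    unfolding ideal3_iff by blast
  then have "r * p = (r * a) * f + (r * b) * g + (r * c) * h" by (simp add: algebra_simps)
  then show "r * p \<in> ideal3 f g h" unfolding ideal3_iff by blast
qed

lemma form_pvar: "form 1 (pvar i)"
  by (simp add: pvar_def form_single mdegree_def lookup_single when_def)

text \<open>In degree \<open>k\<close>, the equation \<open>one\<close> says that \<open>- d\<^sub>k\<close> is congruent to the \<open>k\<close>-th power of the variable.\<close>

lemma ideal3_pvar_power:
  assumes "form n f" "form n g" "form n h"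
    and one: "1 = a * f + b * g + c * h + d * (pvar i - 1)"
  shows "\<exists>N. pvar i ^ N \<in> ideal3 f g h"
proof -
  note I = is_idealD[OF is_ideal_ideal3[of f g h]]
  have comp: "hcomp k 1 - (hcomp (k - 1) d * pvar i - hcomp k d) \<in> ideal3 f g h" for k
  proof -
    have "hcomp k 1 = hcomp k (a * f) + hcomp k (b * g) + hcomp k (c * h) + hcomp k (d * pvar i) - hcomp k d"
      by (subst one) (simp add: hcomp_add hcomp_diff right_diff_distrib)
    then have "hcomp k 1 - (hcomp (k - 1) d * pvar i - hcomp k d)
        = hcomp (k - n) a * f + hcomp (k - n) b * g + hcomp (k - n) c * h"
      using assms(1-3) form_pvar[of i] by (simp add: hcomp_mult_form)
    then show ?thesis unfolding ideal3_iff by blast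
  qed
  have 1: "pvar i ^ k + hcomp (int k) d \<in> ideal3 f g h" for k
  proof (induction k)
    case 0
    have "hcomp (-1) d = 0" by (rule form_neg[OF form_hcomp]) simp
    then show ?case using comp[of 0] by (simp add: hcomp_form[OF form_1])
  next
    case (Suc k)
    have "hcomp (int (Suc k)) d - hcomp (int k) d * pvar i \<in> ideal3 f g h"
      using comp[of "int (Suc k)"] by (simp add: hcomp_form[OF form_1])
    then have "(pvar i ^ k + hcomp (int k) d) * pvar i + (hcomp (int (Suc k)) d - hcomp (int k) d * pvar i)
        \<in> ideal3 f g h"
      using Suc I by blast
    then show ?case by (simp add: algebra_simps)
  qed
  \<comment> \<open>A polynomial has finitely many nonzero components; once the component of
    \<open>d\<close> vanishes, the congruence leaves the pure power.\<close>
  obtain K where "\<forall>k\<ge>K. hcomp (int k) d = 0" using hcomp_eventually_0 by blast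
  then show ?thesis using 1[of K] by (auto simp: exI[of _ K])
qed

text \<open>The generator \<open>pvar i - 1\<close> excludes the origin: if it and the three forms
  generated a proper ideal, there would be a common zero with \<open>i\<close>-th coordinate 1,
  hence a projective zero. So 1 is a combination of the four polynomials, and its homogeneous
  components yield a power of the variable.\<close>

lemma pvar_power_in_ideal3:
  fixes f g h :: "3 mpoly"
  assumes "form n f" "form n g" "form n h"
    and no_zeros: "\<forall>p :: complex ^ 3. p \<noteq> 0 \<longrightarrow> \<not> (eval f p = 0 \<and> eval g p = 0 \<and> eval h p = 0)"
  shows "\<exists>N. pvar i ^ N \<in> ideal3 f g h"
proof (rule ccontr)
  assume "\<not> ?thesis"
  then have no: "1 \<noteq> a * f + b * g + c * h + d * (pvar i - 1)" for a b c d
    using ideal3_pvar_power[OF assms(1-3)] by blast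
  define l :: "3 mpoly" where "l = pvar i - 1"
  define J where "J = {a * complexify f + b * complexify g + c * complexify h + d * complexify l |a b c d. True}"
  have J_iff: "p \<in> J \<longleftrightarrow> (\<exists>a b c d. p = a * complexify f + b * complexify g + c * complexify h + d * complexify l)" for p
    by (auto simp: J_def)
  have "is_ideal J"
    unfolding is_ideal_def
  proof (intro conjI ballI allI)
    show "0 \<in> J" unfolding J_iff by (intro exI[of _ 0]) simp
  next
    fix p q assume "p \<in> J" "q \<in> J"
    then obtain a b c d a' b' c' d' where
      "p = a * complexify f + b * complexify g + c * complexify h + d * complexify l"
      "q = a' * complexify f + b' * complexify g + c' * complexify h + d' * complexify l"
      unfolding J_iff by blast
    then have "p + q = (a + a') * complexify f + (b + b') * complexify g + (c + c') * complexify h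
        + (d + d') * complexify l" by (simp add: algebra_simps)
    then show "p + q \<in> J" unfolding J_iff by blast
  next
    fix r p assume "p \<in> J"
    then obtain a b c d where "p = a * complexify f + b * complexify g + c * complexify h + d * complexify l"
      unfolding J_iff by blast
    then have "r * p = (r * a) * complexify f + (r * b) * complexify g + (r * c) * complexify h
        + (r * d) * complexify l" by (simp add: algebra_simps)
    then show "r * p \<in> J" unfolding J_iff by blast
  qed
  moreover have "1 \<notin> J"
  proof
    assume "1 \<in> J"
    then obtain a b c d where
      "1 = a * complexify f + b * complexify g + c * complexify h + d * complexify l"
      unfolding J_iff by blast
    then have "re_part 1 = re_part (a * complexify f + b * complexify g + c * complexify h + d * complexify l)"
      by simp
    also have "\<dots> = re_part a * f + re_part b * g + re_part c * h + re_part d * (pvar i - 1)"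
      by (simp only: re_part_add re_part_mult_complexify l_def)
    also have "re_part (1 :: (3 \<Rightarrow>\<^sub>0 nat) \<Rightarrow>\<^sub>0 complex) = 1"
      using re_part_single[of "0 :: 3 \<Rightarrow>\<^sub>0 nat" 1] by simp
    finally show False using no by blast
  qed
  ultimately obtain x J' where J': "is_ideal J'" "1 \<notin> J'" "J \<subseteq> J'" "\<And>i. pvar i - cconst (x i) \<in> J'"
    by (rule proper_ideal_point) blast
  let ?x = "(\<chi> i. x i) :: complex ^ 3"
  have ev: "eval p ?x = 0" if "complexify p \<in> J'" for p
    using that J' by (intro eval_zero_of_ideal[OF J'(1,2)]) auto
  have "complexify f \<in> J" unfolding J_iff by (rule exI[of _ 1], rule exI[of _ 0], rule exI[of _ 0], rule exI[of _ 0]) simp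
  moreover have "complexify g \<in> J" unfolding J_iff by (rule exI[of _ 0], rule exI[of _ 1], rule exI[of _ 0], rule exI[of _ 0]) simp
  moreover have "complexify h \<in> J" unfolding J_iff by (rule exI[of _ 0], rule exI[of _ 0], rule exI[of _ 1], rule exI[of _ 0]) simp
  moreover have "complexify l \<in> J" unfolding J_iff by (rule exI[of _ 0], rule exI[of _ 0], rule exI[of _ 0], rule exI[of _ 1]) simp
  ultimately have "eval f ?x = 0" "eval g ?x = 0" "eval h ?x = 0" "eval l ?x = 0"
    using J'(3) by (auto intro!: ev)
  moreover have "eval l ?x = x i - 1"
  proof -
    have "(\<Prod>j\<in>UNIV. x j ^ lookup (single i 1) j) = (\<Prod>j\<in>UNIV. if j = i then x j else 1)"
      by (intro prod.cong) (auto simp: lookup_single when_def)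
    then show ?thesis
      by (simp add: l_def eval_diff pvar_def eval_single)
  qed
  ultimately have "?x \<noteq> 0" by (auto simp: vec_eq_iff intro!: exI[of _ i])
  then show False using no_zeros \<open>eval f ?x = 0\<close> \<open>eval g ?x = 0\<close> \<open>eval h ?x = 0\<close> by blast
qed

subsection \<open>Acyclicity of the Koszul complex\<close>

text \<open>
  The homology of the Koszul complex of \<open>f, g, h\<close> is annihilated by the ideal they generate, hence by
  \<open>X, Y, Z\<close>. As these form a regular sequence, exactness at each place follows from exactness at
  the preceding ones by a diagram chase.
\<close>

context
  fixes f g h X Y Z :: "'a::idom" and x1 x2 x3 y1 y2 y3 z1 z2 z3 :: 'a
  assumes X: "X = x1 * f + x2 * g + x3 * h"
    and Y: "Y = y1 * f + y2 * g + y3 * h"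
    and Z: "Z = z1 * f + z2 * g + z3 * h"
    and nonzero: "X \<noteq> 0"
    and regular2: "\<And>\<alpha> \<beta>. Y * \<alpha> = X * \<beta> \<Longrightarrow> X dvd \<alpha>"
    and regular3: "\<And>\<alpha> \<beta> \<gamma>. Z * \<gamma> = Y * \<alpha> + X * \<beta> \<Longrightarrow> \<exists>c d. \<gamma> = Y * c + X * d"
begin

lemma cancel: "X * a = 0 \<Longrightarrow> a = 0"
  using nonzero by simp

lemma koszul_exact_3:
  assumes "c * f = 0" "c * g = 0" "c * h = 0"
  shows "c = 0"
proof (rule cancel)
  show "X * c = 0" using assms X by algebra
qed

text \<open>Multiplication by \<open>X\<close> or \<open>Y\<close> is null-homotopic, which gives
  \<open>a\<close> and \<open>b\<close> with X (p, q, s) = a (f, g, h) and Y (p, q, s) = b (f, g,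
  h). Then \<open>Y * a - X * b\<close> annihilates f, g and h, so it is zero, and regularity makes
  \<open>a\<close> divisible by \<open>X\<close>.\<close>

lemma koszul_exact_2:
  assumes "q * h = s * g" "s * f = p * h" "p * g = q * f"
  shows "\<exists>c. p = c * f \<and> q = c * g \<and> s = c * h"
proof -
  define a where "a = x1 * p + x2 * q + x3 * s"
  define b where "b = y1 * p + y2 * q + y3 * s"
  have a: "X * p = a * f" "X * q = a * g" "X * s = a * h"
    using assms X a_def by algebra+
  have b: "Y * p = b * f" "Y * q = b * g" "Y * s = b * h"
    using assms Y b_def by algebra+
  have "Y * a - X * b = 0"
    by (rule koszul_exact_3) (use a b in algebra)+
  then have "Y * a = X * b" by simp
  then obtain c where c: "a = X * c" using regular2 by blast
  have "p - c * f = 0" "q - c * g = 0" "s - c * h = 0"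
    by (rule cancel, simp add: right_diff_distrib a c mult.assoc)+
  then have "p = c * f \<and> q = c * g \<and> s = c * h" by simp
  then show ?thesis ..
qed

lemma koszul_exact_1:
  assumes rel: "p * f + q * g + s * h = 0"
  shows "\<exists>d1 d2 d3. p = d2 * h - d3 * g \<and> q = d3 * f - d1 * h \<and> s = d1 * g - d2 * f"
proof -
  \<comment> \<open>Write w = (p, q, s) and F = (f, g, h). The vectors a, b, c are the cross
    products of the coefficient vectors of \<open>X\<close>, \<open>Y\<close>, \<open>Z\<close> with
    w. As w is orthogonal to F, the triple product identity says that the cross product of a with F
    is X w, and likewise for b and c.\<close>
  define a1 where "a1 = x2 * s - x3 * q"
  define a2 where "a2 = x3 * p - x1 * s"
  define a3 where "a3 = x1 * q - x2 * p"
  define b1 where "b1 = y2 * s - y3 * q"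
  define b2 where "b2 = y3 * p - y1 * s"
  define b3 where "b3 = y1 * q - y2 * p"
  define c1 where "c1 = z2 * s - z3 * q"
  define c2 where "c2 = z3 * p - z1 * s"
  define c3 where "c3 = z1 * q - z2 * p"
  have a: "X * p = a2 * h - a3 * g" "X * q = a3 * f - a1 * h" "X * s = a1 * g - a2 * f"
    using rel X a1_def a2_def a3_def by algebra+
  have b: "Y * p = b2 * h - b3 * g" "Y * q = b3 * f - b1 * h" "Y * s = b1 * g - b2 * f"
    using rel Y b1_def b2_def b3_def by algebra+
  have c: "Z * p = c2 * h - c3 * g" "Z * q = c3 * f - c1 * h" "Z * s = c1 * g - c2 * f"
    using rel Z c1_def c2_def c3_def by algebra+
  \<comment> \<open>The vector Y a - X b has zero cross product with F, which is the hypothesis of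
    exactness at the preceding place; the same holds for the other two pairs.\<close>
  have "\<exists>k. Y * a1 - X * b1 = k * f \<and> Y * a2 - X * b2 = k * g \<and> Y * a3 - X * b3 = k * h"
  proof (rule koszul_exact_2)
    show "(Y * a2 - X * b2) * h = (Y * a3 - X * b3) * g" using a(1) b(1) by algebra
    show "(Y * a3 - X * b3) * f = (Y * a1 - X * b1) * h" using a(2) b(2) by algebra
    show "(Y * a1 - X * b1) * g = (Y * a2 - X * b2) * f" using a(3) b(3) by algebra
  qed
  then obtain k where k: "Y * a1 - X * b1 = k * f" "Y * a2 - X * b2 = k * g" "Y * a3 - X * b3 = k * h"
    by blast
  have "\<exists>l. Z * a1 - X * c1 = l * f \<and> Z * a2 - X * c2 = l * g \<and> Z * a3 - X * c3 = l * h"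
  proof (rule koszul_exact_2)
    show "(Z * a2 - X * c2) * h = (Z * a3 - X * c3) * g" using a(1) c(1) by algebra
    show "(Z * a3 - X * c3) * f = (Z * a1 - X * c1) * h" using a(2) c(2) by algebra
    show "(Z * a1 - X * c1) * g = (Z * a2 - X * c2) * f" using a(3) c(3) by algebra
  qed
  then obtain l where l: "Z * a1 - X * c1 = l * f" "Z * a2 - X * c2 = l * g" "Z * a3 - X * c3 = l * h"
    by blast
  have "\<exists>m. Z * b1 - Y * c1 = m * f \<and> Z * b2 - Y * c2 = m * g \<and> Z * b3 - Y * c3 = m * h"
  proof (rule koszul_exact_2)
    show "(Z * b2 - Y * c2) * h = (Z * b3 - Y * c3) * g" using b(1) c(1) by algebra
    show "(Z * b3 - Y * c3) * f = (Z * b1 - Y * c1) * h" using b(2) c(2) by algebra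
    show "(Z * b1 - Y * c1) * g = (Z * b2 - Y * c2) * f" using b(3) c(3) by algebra
  qed
  then obtain m where m: "Z * b1 - Y * c1 = m * f" "Z * b2 - Y * c2 = m * g" "Z * b3 - Y * c3 = m * h"
    by blast
  \<comment> \<open>The identity Z (Y a - X b) - Y (Z a - X c) + X (Z b - Y c) = 0 becomes a
    relation among \<open>k\<close>, \<open>l\<close>, \<open>m\<close> times F.\<close>
  have aux: "(Z * k - (Y * l - X * m)) * e = 0"
    if "Y * a - X * b = k * e" "Z * a - X * c = l * e" "Z * b - Y * c = m * e" for e a b c
  proof -
    have "(Z * k - (Y * l - X * m)) * e = Z * (k * e) - Y * (l * e) + X * (m * e)"
      by (simp add: algebra_simps)
    also have "\<dots> = 0"
      unfolding that[symmetric] by (simp add: algebra_simps)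
    finally show ?thesis .
  qed
  have "Z * k - (Y * l - X * m) = 0"
    by (rule koszul_exact_3[OF aux[OF k(1) l(1) m(1)] aux[OF k(2) l(2) m(2)] aux[OF k(3) l(3) m(3)]])
  then have "Z * k = Y * l + X * (- m)" by (simp add: algebra_simps)
  then obtain u v where k': "k = Y * u + X * v" using regular3 by blast
  \<comment> \<open>Changing a by a multiple of F does not affect its cross product with F, so the
    quotient of a - u F by \<open>X\<close> is the required Koszul preimage.\<close>
  have "Y * (a1 - u * f) = X * (b1 + v * f)" "Y * (a2 - u * g) = X * (b2 + v * g)"
      "Y * (a3 - u * h) = X * (b3 + v * h)"
    using k by (simp_all add: k' algebra_simps)
  then obtain d1 d2 d3 where d: "a1 - u * f = X * d1" "a2 - u * g = X * d2" "a3 - u * h = X * d3"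
    using regular2 by (meson dvdE)
  have "p - (d2 * h - d3 * g) = 0" "q - (d3 * f - d1 * h) = 0" "s - (d1 * g - d2 * f) = 0"
  proof -
    have a': "a1 = X * d1 + u * f" "a2 = X * d2 + u * g" "a3 = X * d3 + u * h"
      using d by (simp_all add: algebra_simps)
    show "p - (d2 * h - d3 * g) = 0" "q - (d3 * f - d1 * h) = 0" "s - (d1 * g - d2 * f) = 0"
      by (rule cancel, simp add: right_diff_distrib a, simp add: a' algebra_simps)+
  qed
  then have "p = d2 * h - d3 * g \<and> q = d3 * f - d1 * h \<and> s = d1 * g - d2 * f" by simp
  then show ?thesis by blast
qed

end

section \<open>Powers of distinct variables as a regular sequence\<close>

lemma pvar_nonzero: "pvar i \<noteq> (0 :: ('v \<Rightarrow>\<^sub>0 nat) \<Rightarrow>\<^sub>0 'b::zero_neq_one)"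
proof
  assume "pvar i = (0 :: ('v \<Rightarrow>\<^sub>0 nat) \<Rightarrow>\<^sub>0 'b)"
  then have "lookup (pvar i) (single i 1) = (0 :: 'b)" by simp
  then show False by (simp add: pvar_def)
qed

lemma pvar_power: "pvar i ^ N = (single (single i N) 1 :: ('v \<Rightarrow>\<^sub>0 nat) \<Rightarrow>\<^sub>0 'b::comm_semiring_1)"
proof (induction N)
  case (Suc N)
  then show ?case by (simp add: pvar_def mult_single flip: single_add)
qed simp

lemma lookup_pvar_power_times:
  fixes p :: "('v \<Rightarrow>\<^sub>0 nat) \<Rightarrow>\<^sub>0 'b::comm_semiring_1"
  shows "lookup (pvar i ^ N * p) (single i N + m) = lookup p m"
  by (simp add: pvar_power lookup_single_times)

lemma pvar_power_dvd_iff: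
  fixes p :: "('v \<Rightarrow>\<^sub>0 nat) \<Rightarrow>\<^sub>0 'b::comm_semiring_1"
  shows "pvar i ^ N dvd p \<longleftrightarrow> (\<forall>m. lookup p m \<noteq> 0 \<longrightarrow> N \<le> lookup m i)"
proof (intro iffI allI impI)
  fix m assume "pvar i ^ N dvd p" "lookup p m \<noteq> 0"
  then obtain q where "p = pvar i ^ N * q" by (elim dvdE)
  with \<open>lookup p m \<noteq> 0\<close> have "lookup (single (single i N) 1 * q) m \<noteq> 0" by (simp add: pvar_power)
  then obtain l where "m = single i N + l" using lookup_single_times_other by blast
  then show "N \<le> lookup m i" by (simp add: lookup_add)
next
  assume *: "\<forall>m. lookup p m \<noteq> 0 \<longrightarrow> N \<le> lookup m i"
  have "pvar i ^ N dvd single m (lookup p m)" if "m \<in> keys p" for m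
  proof -
    have "m = single i N + (m - single i N)"
      using * that by (intro poly_mapping_eqI) (auto simp: lookup_add lookup_minus lookup_single when_def in_keys_iff)
    then have "single m (lookup p m) = pvar i ^ N * single (m - single i N) (lookup p m)"
      by (simp add: pvar_power mult_single)
    then show ?thesis by simp
  qed
  then show "pvar i ^ N dvd p"
    by (subst poly_mapping_sum_single) (rule dvd_sum)
qed

text \<open>Multiplication by a power of another variable leaves the exponents of variable
  \<open>i\<close> unchanged.\<close>

lemma pvar_power_regular2:
  fixes a b :: "('v \<Rightarrow>\<^sub>0 nat) \<Rightarrow>\<^sub>0 'b::comm_semiring_1"
  assumes "i \<noteq> j" "pvar j ^ M * a = pvar i ^ N * b"
  shows "pvar i ^ N dvd a"
  unfolding pvar_power_dvd_iff
proof (intro allI impI)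
  fix m assume "lookup a m \<noteq> 0"
  then have "lookup (pvar i ^ N * b) (single j M + m) \<noteq> 0"
    using assms(2) lookup_pvar_power_times[of j M a m] by simp
  moreover have "pvar i ^ N dvd pvar i ^ N * b" by simp
  ultimately have "N \<le> lookup (single j M + m) i" unfolding pvar_power_dvd_iff by blast
  then show "N \<le> lookup m i" using assms(1) by (simp add: lookup_add lookup_single)
qed

lemma pvar_power_regular3:
  fixes a b c :: "('v \<Rightarrow>\<^sub>0 nat) \<Rightarrow>\<^sub>0 'b::comm_ring_1"
  assumes "i \<noteq> k" "j \<noteq> k" "pvar k ^ L * c = pvar j ^ M * a + pvar i ^ N * b"
  shows "\<exists>u v. c = pvar j ^ M * u + pvar i ^ N * v"
proof -
  \<comment> \<open>The part of \<open>c\<close> made of the monomials divisible by the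
    \<open>N\<close>-th power of variable \<open>i\<close>. A monomial of the rest, times the power
    of variable \<open>k\<close>, must come from the multiple of the power of variable
    \<open>j\<close>.\<close>
  define d where "d = (\<Sum>m | m \<in> keys c \<and> N \<le> lookup m i. single m (lookup c m))"
  have d: "lookup d m = (if N \<le> lookup m i then lookup c m else 0)" for m
  proof -
    have "lookup d m = (\<Sum>l | l \<in> keys c \<and> N \<le> lookup l i. if l = m then lookup c l else 0)"
      by (simp add: d_def lookup_sum lookup_single when_def)
    also have "\<dots> = (if N \<le> lookup m i then lookup c m else 0)"
      by (subst sum.delta) (auto simp: not_in_keys_iff_lookup_eq_zero)
    finally show ?thesis .
  qed
  have "pvar i ^ N dvd d"
    unfolding pvar_power_dvd_iff by (simp add: d)
  moreover have "pvar j ^ M dvd c - d"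
    unfolding pvar_power_dvd_iff
  proof (intro allI impI)
    fix m assume "lookup (c - d) m \<noteq> 0"
    then have m: "\<not> N \<le> lookup m i" "lookup c m \<noteq> 0"
      by (auto simp: lookup_minus d split: if_splits)
    let ?m = "single k L + m"
    have "lookup (pvar j ^ M * a) ?m + lookup (pvar i ^ N * b) ?m \<noteq> 0"
      using m(2) assms(3) lookup_pvar_power_times[of k L c m] by (simp flip: lookup_add)
    moreover have "lookup (pvar i ^ N * b) ?m = 0"
      using m(1) pvar_power_dvd_iff[of i N "pvar i ^ N * b"] assms(1)
      by (auto simp: lookup_add lookup_single when_def)
    ultimately have "lookup (pvar j ^ M * a) ?m \<noteq> 0" by simp
    then have "M \<le> lookup ?m j"
      using pvar_power_dvd_iff[of j M "pvar j ^ M * a"] by auto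
    then show "M \<le> lookup m j" using assms(2) by (simp add: lookup_add lookup_single when_def)
  qed
  ultimately obtain u v where "d = pvar i ^ N * v" "c - d = pvar j ^ M * u" by (auto elim!: dvdE)
  then have "c = pvar j ^ M * u + pvar i ^ N * v" by (simp add: algebra_simps)
  then show ?thesis by blast
qed

lemma koszul_forms:
  fixes f g h :: "3 mpoly"
  assumes forms: "form n f" "form n g" "form n h"
    and no_zeros: "\<forall>p :: complex ^ 3. p \<noteq> 0 \<longrightarrow> \<not> (eval f p = 0 \<and> eval g p = 0 \<and> eval h p = 0)"
    and rel: "p * f + q * g + s * h = 0" and pqs: "form d p" "form d q" "form d s"
  obtains d1 d2 d3 where "form (d - n) d1" "form (d - n) d2" "form (d - n) d3"
    "p = d2 * h - d3 * g" "q = d3 * f - d1 * h" "s = d1 * g - d2 * f"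
proof -
  obtain N1 N2 N3 where N: "pvar 1 ^ N1 \<in> ideal3 f g h" "pvar 2 ^ N2 \<in> ideal3 f g h"
      "pvar 3 ^ N3 \<in> ideal3 f g h"
    using pvar_power_in_ideal3[OF forms no_zeros] by meson
  then obtain x1 x2 x3 y1 y2 y3 z1 z2 z3 where
    "pvar 1 ^ N1 = x1 * f + x2 * g + x3 * h"
    "pvar 2 ^ N2 = y1 * f + y2 * g + y3 * h"
    "pvar 3 ^ N3 = z1 * f + z2 * g + z3 * h"
    unfolding ideal3_iff by blast
  then have "\<exists>d1 d2 d3. p = d2 * h - d3 * g \<and> q = d3 * f - d1 * h \<and> s = d1 * g - d2 * f"
  proof (rule koszul_exact_1[OF _ _ _ _ _ _ rel])
    show "(pvar 1 :: 3 mpoly) ^ N1 \<noteq> 0"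
      by (simp add: pvar_nonzero)
  next
    fix \<alpha> \<beta> :: "3 mpoly" assume "pvar 2 ^ N2 * \<alpha> = pvar 1 ^ N1 * \<beta>"
    then show "pvar 1 ^ N1 dvd \<alpha>" by (rule pvar_power_regular2[rotated]) simp
  next
    fix \<alpha> \<beta> \<gamma> :: "3 mpoly" assume "pvar 3 ^ N3 * \<gamma> = pvar 2 ^ N2 * \<alpha> + pvar 1 ^ N1 * \<beta>"
    then show "\<exists>c d. \<gamma> = pvar 2 ^ N2 * c + pvar 1 ^ N1 * d"
      by (rule pvar_power_regular3[rotated 2]) simp_all
  qed
  then obtain d1 d2 d3 where *: "p = d2 * h - d3 * g" "q = d3 * f - d1 * h" "s = d1 * g - d2 * f"
    by blast
  \<comment> \<open>The degrees are imposed afterwards: taking components of degree \<open>d\<close>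
    replaces each Koszul coefficient by its component of degree \<open>d - n\<close>.\<close>
  have "p = hcomp d p" "q = hcomp d q" "s = hcomp d s"
    using pqs by (simp_all add: hcomp_form)
  then show ?thesis
    by (intro that[of "hcomp (d - n) d1" "hcomp (d - n) d2" "hcomp (d - n) d3"])
      (simp_all add: form_hcomp, simp_all add: * hcomp_diff hcomp_mult_form[OF forms(1)]
        hcomp_mult_form[OF forms(2)] hcomp_mult_form[OF forms(3)])
qed

subsection \<open>Dimensions\<close>

lemma independent_family:
  fixes v :: "'k \<Rightarrow> 'a::real_vector"
  assumes K: "finite K" and 0: "\<And>c. (\<Sum>k\<in>K. c k *\<^sub>R v k) = 0 \<Longrightarrow> \<forall>k\<in>K. c k = 0"
  shows "inj_on v K" "independent (v ` K)"
proof -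
  show inj: "inj_on v K"
  proof (rule inj_onI, rule ccontr)
    fix k l assume kl: "k \<in> K" "l \<in> K" "v k = v l" "k \<noteq> l"
    let ?c = "\<lambda>i. if i = k then 1 else if i = l then - 1 else 0 :: real"
    have "(\<Sum>i\<in>K. ?c i *\<^sub>R v i) = (\<Sum>i\<in>{k, l}. ?c i *\<^sub>R v i)"
      using K kl by (intro sum.mono_neutral_right) auto
    also have "\<dots> = 0" using kl by simp
    finally show False using 0[of ?c] kl by auto
  qed
  show "independent (v ` K)"
  proof
    assume "dependent (v ` K)"
    then obtain u where u: "\<exists>x\<in>v ` K. u x \<noteq> 0" "(\<Sum>x\<in>v ` K. u x *\<^sub>R x) = 0"
      using K dependent_finite[of "v ` K"] by auto
    then have "(\<Sum>k\<in>K. u (v k) *\<^sub>R v k) = 0"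
      by (simp add: sum.reindex[OF inj])
    then show False using 0[of "\<lambda>k. u (v k)"] u(1) by auto
  qed
qed

lemma finite_basis:
  fixes W :: "'a::real_vector set"
  assumes W: "subspace W" and Z: "finite Z" "W \<subseteq> span Z"
  obtains B where "finite B" "B \<subseteq> W" "independent B" "span B = W" "card B = dim W"
proof -
  obtain B where B: "B \<subseteq> W" "independent B" "W \<subseteq> span B" "card B = dim W"
    by (rule basis_exists)
  then have "finite B" using independent_span_bound[OF Z(1), of B] Z(2) by auto
  moreover have "span B = W" using B W by (simp add: span_minimal subset_antisym)
  ultimately show ?thesis using B that by blast
qed

text \<open>A family \<open>w\<close> stands for an element of the external direct sum of the
  \<open>W i\<close>, and \<open>inj\<close>, \<open>into\<close>, \<open>surj\<close> make the sum
  map a bijection onto \<open>V\<close>. It serves for forms and for splines alike.\<close>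

lemma dim_direct_sum:
  fixes T :: "'i \<Rightarrow> 'w::real_vector \<Rightarrow> 'v::real_vector"
  assumes I: "finite I" and lin: "\<And>i. i \<in> I \<Longrightarrow> linear (T i)"
    and W: "\<And>i. i \<in> I \<Longrightarrow> subspace (W i)" "\<And>i. i \<in> I \<Longrightarrow> \<exists>Z. finite Z \<and> W i \<subseteq> span Z"
    and inj: "\<And>w. \<forall>i\<in>I. w i \<in> W i \<Longrightarrow> (\<Sum>i\<in>I. T i (w i)) = 0 \<Longrightarrow> \<forall>i\<in>I. w i = 0"
    and into: "\<And>i w. i \<in> I \<Longrightarrow> w \<in> W i \<Longrightarrow> T i w \<in> V"
    and surj: "\<And>v. v \<in> V \<Longrightarrow> \<exists>w. (\<forall>i\<in>I. w i \<in> W i) \<and> v = (\<Sum>i\<in>I. T i (w i))"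
  shows "dim V = (\<Sum>i\<in>I. dim (W i))"
proof -
  have "\<exists>B. finite B \<and> B \<subseteq> W i \<and> independent B \<and> span B = W i \<and> card B = dim (W i)" if "i \<in> I" for i
    using W[OF that] by (metis finite_basis)
  then obtain B where B: "\<And>i. i \<in> I \<Longrightarrow> finite (B i) \<and> B i \<subseteq> W i \<and> independent (B i)
      \<and> span (B i) = W i \<and> card (B i) = dim (W i)"
    by metis
  define v where "v = (\<lambda>(i, b). T i b)"
  have scale: "T i (\<Sum>b\<in>B i. c b *\<^sub>R b) = (\<Sum>b\<in>B i. c b *\<^sub>R T i b)" if "i \<in> I" for i c
    using lin[OF that] by (simp add: linear_sum linear_cmul)
  have ind: "\<forall>k\<in>Sigma I B. c k = 0" if "(\<Sum>k\<in>Sigma I B. c k *\<^sub>R v k) = 0" for c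
  proof -
    define w where "w i = (\<Sum>b\<in>B i. c (i, b) *\<^sub>R b)" for i
    have "(\<Sum>i\<in>I. T i (w i)) = (\<Sum>i\<in>I. \<Sum>b\<in>B i. c (i, b) *\<^sub>R T i b)"
      by (intro sum.cong refl) (simp add: w_def scale)
    also have "\<dots> = (\<Sum>(i, b)\<in>Sigma I B. c (i, b) *\<^sub>R T i b)"
      using I B by (intro sum.Sigma) auto
    also have "\<dots> = (\<Sum>k\<in>Sigma I B. c k *\<^sub>R v k)"
      by (intro sum.cong) (auto simp: v_def)
    finally have "(\<Sum>k\<in>Sigma I B. c k *\<^sub>R v k) = (\<Sum>i\<in>I. T i (w i))" ..
    moreover have "w i \<in> W i" if "i \<in> I" for i
    proof -
      have "w i \<in> span (B i)"
        unfolding w_def by (intro span_sum span_scale span_base)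
      then show ?thesis using B[OF that] by simp
    qed
    ultimately have w0: "\<forall>i\<in>I. w i = 0" using inj that by simp
    show ?thesis
    proof clarify
      fix i b assume "i \<in> I" "b \<in> B i"
      then show "c (i, b) = 0"
        using independentD[of "B i" "B i" "\<lambda>b. c (i, b)" b] B w0 by (auto simp: w_def)
    qed
  qed
  have fin: "finite (Sigma I B)" using I B by auto
  note fam = independent_family[OF fin ind]
  have "dim V = card (v ` Sigma I B)"
  proof (rule dim_unique[OF _ _ fam(2) refl])
    show "v ` Sigma I B \<subseteq> V"
    proof clarify
      fix i b assume "i \<in> I" "b \<in> B i"
      then show "v (i, b) \<in> V" unfolding v_def using B[of i] into[of i b] by auto
    qed
    show "V \<subseteq> span (v ` Sigma I B)"
    proof
      fix x assume "x \<in> V"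
      then obtain w where w: "\<forall>i\<in>I. w i \<in> W i" "x = (\<Sum>i\<in>I. T i (w i))" using surj by blast
      have "T i (w i) \<in> span (v ` Sigma I B)" if "i \<in> I" for i
      proof -
        have "w i \<in> span (B i)" using w(1) B that by auto
        then have "T i (w i) \<in> span (T i ` B i)"
          using linear_span_image[OF lin[OF that], of "B i"] by blast
        moreover have "T i ` B i \<subseteq> v ` Sigma I B" using that by (force simp: v_def)
        ultimately show ?thesis using span_mono by blast
      qed
      then show "x \<in> span (v ` Sigma I B)" unfolding w(2) by (rule span_sum)
    qed
  qed
  also have "\<dots> = card (Sigma I B)" by (rule card_image[OF fam(1)])
  also have "\<dots> = (\<Sum>i\<in>I. dim (W i))" using I B by simp
  finally show ?thesis .
qed

lemma forms_finite_dim: "\<exists>Z. finite Z \<and> {p :: 'v::finite mpoly. form d p} \<subseteq> span Z"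
proof -
  let ?M = "{m :: 'v \<Rightarrow>\<^sub>0 nat. mdegree m \<le> nat d}"
  let ?Z = "(\<lambda>m. single m (1::real)) ` ?M"
  have "p \<in> span ?Z" if "form d p" for p :: "'v mpoly"
  proof -
    have "single m (lookup p m) \<in> span ?Z" if "m \<in> keys p" for m
      using that \<open>form d p\<close> unfolding single_scaleR[of m "lookup p m"]
      by (intro span_scale span_base) (auto simp: form_def)
    then have "(\<Sum>m\<in>keys p. single m (lookup p m)) \<in> span ?Z" by (rule span_sum)
    then show ?thesis by (simp flip: poly_mapping_sum_single)
  qed
  then show ?thesis by (intro exI[of _ ?Z]) (auto simp: finite_mdegree_le)
qed

lemma mdegree_3: "mdegree (m :: 3 \<Rightarrow>\<^sub>0 nat) = lookup m 1 + lookup m 2 + lookup m 3"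
  unfolding mdegree_def UNIV_3 by simp

lemma dim_zero_space: "dim {0 :: 'a::real_vector} = 0"
  using dim_unique[of "{}" "{0 :: 'a}" 0] independent_empty by simp

lemma form_0_constant:
  fixes p :: "'v::finite mpoly"
  assumes "form 0 p"
  shows "\<exists>c. p = c *\<^sub>R 1"
proof -
  have "p = lookup p 0 *\<^sub>R 1"
  proof (rule poly_mapping_eqI)
    fix m :: "'v \<Rightarrow>\<^sub>0 nat"
    have "m = 0" if "mdegree m = 0"
      using that by (auto simp: mdegree_def intro!: poly_mapping_eqI)
    then show "lookup p m = lookup (lookup p 0 *\<^sub>R 1) m"
      using assms by (auto simp: form_iff lookup_one when_def)
  qed
  then show ?thesis ..
qed

subsection \<open>Freeness over the ring of the net\<close>

locale net =
  fixes f g h :: "3 mpoly" and n :: nat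
  assumes forms: "form (int n) f" "form (int n) g" "form (int n) h"
    and distinct: "distinct [f, g, h]" and independent: "independent {f, g, h}"
    and no_zeros: "\<forall>p :: complex ^ 3. p \<noteq> 0 \<longrightarrow> \<not> (eval f p = 0 \<and> eval g p = 0 \<and> eval h p = 0)"
begin

text \<open>Forms of degree zero are constants, among which there are no three independent
  ones.\<close>

lemma degree_pos: "n > 0"
proof (rule ccontr)
  assume "\<not> n > 0"
  then have "\<exists>c. p = c *\<^sub>R 1" if "form (int n) p" for p :: "3 mpoly"
    using that form_0_constant by simp
  then have "p \<in> span {1}" if "form (int n) p" for p :: "3 mpoly"
    using that by (metis span_base span_scale insertI1)
  then have "{f, g, h} \<subseteq> span {1}" using forms by auto
  then have "card {f, g, h} \<le> card {1 :: 3 mpoly}"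
    using independent_span_bound[of "{1 :: 3 mpoly}" "{f, g, h}"] independent by auto
  then show False using distinct by simp
qed

abbreviation \<phi> :: "3 mpoly \<Rightarrow> 3 mpoly" where "\<phi> \<equiv> pullback f g h"
abbreviation I :: "3 mpoly set" where "I \<equiv> ideal3 f g h"

lemma \<phi>_add: "\<phi> (p + q) = \<phi> p + \<phi> q" by (simp add: pullback_def eval_add)
lemma \<phi>_diff: "\<phi> (p - q) = \<phi> p - \<phi> q" by (simp add: pullback_def eval_diff)
lemma \<phi>_mult: "\<phi> (p * q) = \<phi> p * \<phi> q" by (simp add: pullback_def eval_mult)
lemma \<phi>_power: "\<phi> (p ^ k) = \<phi> p ^ k" by (simp add: pullback_def eval_power)
lemma \<phi>_scaleR: "\<phi> (c *\<^sub>R p) = c *\<^sub>R \<phi> p" by (simp add: pullback_def eval_scaleR)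
lemma \<phi>_0 [simp]: "\<phi> 0 = 0" by (simp add: pullback_def)
lemma \<phi>_1 [simp]: "\<phi> 1 = 1" by (simp add: pullback_def)

lemma \<phi>_single: "\<phi> (single m c) = c *\<^sub>R (f ^ lookup m 1 * g ^ lookup m 2 * h ^ lookup m 3)"
  unfolding pullback_def eval_single UNIV_3 by simp

lemma \<phi>_pvar [simp]: "\<phi> (pvar 1) = f" "\<phi> (pvar 2) = g" "\<phi> (pvar 3) = h"
  by (simp_all add: pvar_def \<phi>_single lookup_single when_def)

lemma form_\<phi>: "form k p \<Longrightarrow> form (int n * k) (\<phi> p)"
proof -
  assume p: "form k p"
  have "form (int n * k) (\<phi> (single m (lookup p m)))" if "m \<in> keys p" for m
  proof -
    have k: "k = int (lookup m 1) + int (lookup m 2) + int (lookup m 3)"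
      using p that by (auto simp: form_def mdegree_3)
    have "form (int (lookup m 1) * int n + int (lookup m 2) * int n + int (lookup m 3) * int n)
       (f ^ lookup m 1 * g ^ lookup m 2 * h ^ lookup m 3)"
      by (intro form_mult form_power forms)
    then show ?thesis unfolding \<phi>_single k by (intro form_scaleR) (simp add: algebra_simps)
  qed
  then have "form (int n * k) (\<Sum>m\<in>keys p. \<phi> (single m (lookup p m)))" by (rule form_sum)
  moreover have "(\<Sum>m\<in>keys p. \<phi> (single m (lookup p m))) = \<phi> (\<Sum>m\<in>keys p. single m (lookup p m))"
    unfolding pullback_def by (rule eval_sum[symmetric])
  ultimately show ?thesis
    by (simp flip: poly_mapping_sum_single)
qed

text \<open>Such an \<open>E\<close> consists of lifts of a basis of the degree \<open>d\<close>
  part of S/I.\<close>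

definition is_complement :: "int \<Rightarrow> 3 mpoly set \<Rightarrow> bool" where
  "is_complement d E \<longleftrightarrow> finite E \<and> (\<forall>e\<in>E. form d e) \<and> card E = quotient_dim f g h d \<and>
     (\<forall>p. form d p \<longrightarrow> (\<exists>c. p - (\<Sum>e\<in>E. c e *\<^sub>R e) \<in> I)) \<and>
     (\<forall>c. (\<Sum>e\<in>E. c e *\<^sub>R e) \<in> I \<longrightarrow> (\<forall>e\<in>E. c e = 0))"

lemma subspace_I: "subspace I"
  using is_idealD[OF is_ideal_ideal3[of f g h]]
  by (auto simp: subspace_def scaleR_eq_single_times)

lemma complement_exists: "\<exists>E. is_complement d E"
proof -
  let ?S = "{p :: 3 mpoly. form d p}" and ?Id = "{p \<in> I. form d p}"
  obtain Z where Z: "finite Z" "?S \<subseteq> span Z" using forms_finite_dim by blast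
  have sub: "subspace ?Id"
    using subspace_inter[OF subspace_I subspace_form[of d]] by (simp add: Int_def)
  have "?Id \<subseteq> span Z" using Z by auto
  then obtain B where B: "finite B" "B \<subseteq> ?Id" "independent B" "span B = ?Id" "card B = dim ?Id"
    by (rule finite_basis[OF sub Z(1)])
  \<comment> \<open>A basis of the degree \<open>d\<close> part of the ideal is extended to one of
    all forms; the added vectors are the complement.\<close>
  obtain C where C: "B \<subseteq> C" "C \<subseteq> ?S" "independent C" "?S \<subseteq> span C"
    using maximal_independent_subset_extend[of B ?S] B by auto
  have finC: "finite C" using independent_span_bound[OF Z(1) C(3)] C Z by auto
  have cardC: "card C = dim ?S" using basis_card_eq_dim C by blast
  have "is_complement d (C - B)"
    unfolding is_complement_def
  proof (intro conjI allI impI)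
    show "finite (C - B)" using finC by simp
    show "\<forall>e\<in>C - B. form d e" using C by auto
    show "card (C - B) = quotient_dim f g h d"
      unfolding quotient_dim_def using C(1) B(1,5) cardC by (simp add: card_Diff_subset)
  next
    fix p :: "3 mpoly" assume "form d p"
    then have "p \<in> span C" using C by auto
    then obtain c where c: "p = (\<Sum>e\<in>C. c e *\<^sub>R e)"
      using span_finite[OF finC] by auto
    have "p - (\<Sum>e\<in>C - B. c e *\<^sub>R e) = (\<Sum>e\<in>B. c e *\<^sub>R e)"
      unfolding c using sum.subset_diff[OF C(1) finC, of "\<lambda>e. c e *\<^sub>R e"] by simp
    also have "\<dots> \<in> span B" by (intro span_sum span_scale span_base)
    finally show "\<exists>c. p - (\<Sum>e\<in>C - B. c e *\<^sub>R e) \<in> I" using B(4) by auto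
  next
    fix c assume "(\<Sum>e\<in>C - B. c e *\<^sub>R e) \<in> I"
    moreover have "form d (\<Sum>e\<in>C - B. c e *\<^sub>R e)"
      using C by (intro form_sum form_scaleR) auto
    ultimately have "(\<Sum>e\<in>C - B. c e *\<^sub>R e) \<in> span B" using B(4) by auto
    then obtain b where b: "(\<Sum>e\<in>C - B. c e *\<^sub>R e) = (\<Sum>e\<in>B. b e *\<^sub>R e)"
      using span_finite[OF B(1)] by auto
    let ?c = "\<lambda>e. if e \<in> B then - b e else c e"
    have "(\<Sum>e\<in>C. ?c e *\<^sub>R e) = (\<Sum>e\<in>C - B. ?c e *\<^sub>R e) + (\<Sum>e\<in>B. ?c e *\<^sub>R e)"
      by (rule sum.subset_diff[OF C(1) finC])
    also have "\<dots> = 0" using b by (simp add: sum_negf)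
    finally have *: "(\<Sum>e\<in>C. ?c e *\<^sub>R e) = 0" .
    have "?c e = 0" if "e \<in> C" for e
      using independentD[OF C(3) finC order_refl *] that .
    then show "\<forall>e\<in>C - B. c e = 0" by force
  qed
  then show ?thesis ..
qed

definition E :: "int \<Rightarrow> 3 mpoly set" where "E d = (SOME E. is_complement d E)"

lemma E: "is_complement d (E d)"
  unfolding E_def using complement_exists by (rule someI_ex)

lemma finite_E [simp]: "finite (E d)" and form_E: "e \<in> E d \<Longrightarrow> form d e"
  and card_E: "card (E d) = quotient_dim f g h d"
  and E_spans: "form d p \<Longrightarrow> \<exists>c. p - (\<Sum>e\<in>E d. c e *\<^sub>R e) \<in> I"
  and E_independent: "(\<Sum>e\<in>E d. c e *\<^sub>R e) \<in> I \<Longrightarrow> e \<in> E d \<Longrightarrow> c e = 0"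
  using E[of d] by (auto simp: is_complement_def)

end

text \<open>Applied to coefficients in R, this separates the constant term, which can occur only in
  degree zero, from the part in (u, v, w).\<close>

lemma form_decompose:
  fixes p :: "3 mpoly"
  assumes "form k p"
  shows "\<exists>c p1 p2 p3. p = single 0 c + pvar 1 * p1 + pvar 2 * p2 + pvar 3 * p3 \<and> (c \<noteq> 0 \<longrightarrow> k = 0)
    \<and> form (k - 1) p1 \<and> form (k - 1) p2 \<and> form (k - 1) p3"
proof -
  have "\<exists>c p1 p2 p3. p = single 0 c + pvar 1 * p1 + pvar 2 * p2 + pvar 3 * p3"
  proof (induction p rule: poly_mapping_single_induct)
    case zero
    show ?case by (intro exI[of _ 0]) simp
  next
    case (single m c)
    have *: "single m c = pvar i * single (m - single i 1) c" if "lookup m i \<noteq> 0" for i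
    proof -
      have "m = single i 1 + (m - single i 1)"
        using that by (intro poly_mapping_eqI) (auto simp: lookup_add lookup_minus lookup_single when_def)
      then show ?thesis by (simp add: pvar_def mult_single)
    qed
    consider "m = 0" | i where "lookup m i \<noteq> 0" by (metis lookup_zero poly_mapping_eqI)
    then show ?case
    proof cases
      case 1
      then show ?thesis by (intro exI[of _ c] exI[of _ 0]) simp
    next
      case (2 i)
      from *[OF 2] obtain q where q: "single m c = pvar i * q" by blast
      have "i = 1 \<or> i = 2 \<or> i = 3" using exhaust_3 by blast
      then show ?thesis
      proof (elim disjE)
        assume "i = 1"
        with q have "single m c = single 0 0 + pvar 1 * q + pvar 2 * 0 + pvar 3 * 0" by simp
        then show ?thesis by blast
      next
        assume "i = 2"
        with q have "single m c = single 0 0 + pvar 1 * 0 + pvar 2 * q + pvar 3 * 0" by simp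
        then show ?thesis by blast
      next
        assume "i = 3"
        with q have "single m c = single 0 0 + pvar 1 * 0 + pvar 2 * 0 + pvar 3 * q" by simp
        then show ?thesis by blast
      qed
    qed
  next
    case (add p q)
    then obtain c p1 p2 p3 c' q1 q2 q3 where
      "p = single 0 c + pvar 1 * p1 + pvar 2 * p2 + pvar 3 * p3"
      "q = single 0 c' + pvar 1 * q1 + pvar 2 * q2 + pvar 3 * q3" by blast
    then have "p + q = single 0 (c + c') + pvar 1 * (p1 + q1) + pvar 2 * (p2 + q2) + pvar 3 * (p3 + q3)"
      by (simp add: single_add algebra_simps)
    then show ?case by blast
  qed
  then obtain c p1 p2 p3 where p: "p = single 0 c + pvar 1 * p1 + pvar 2 * p2 + pvar 3 * p3" by blast
  have *: "hcomp k (pvar i * q) = pvar i * hcomp (k - 1) q" for i q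
    using hcomp_mult_form[OF form_pvar[of i], of k q] by (simp add: mult.commute)
  have c: "hcomp k (single 0 c) = single 0 (if k = 0 then c else 0)"
    using hcomp_form[of 0 "single 0 c" k] by (cases "k = 0") (simp_all add: form_single)
  have "p = hcomp k p" using assms by (simp add: hcomp_form)
  also have "\<dots> = single 0 (if k = 0 then c else 0) + pvar 1 * hcomp (k - 1) p1
      + pvar 2 * hcomp (k - 1) p2 + pvar 3 * hcomp (k - 1) p3"
    by (subst p) (simp only: hcomp_add * c)
  finally have "p = single 0 (if k = 0 then c else 0) + pvar 1 * hcomp (k - 1) p1
      + pvar 2 * hcomp (k - 1) p2 + pvar 3 * hcomp (k - 1) p3" .
  moreover have "(if k = 0 then c else 0) \<noteq> 0 \<longrightarrow> k = 0" by simp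
  ultimately show ?thesis using form_hcomp by blast
qed

context net
begin

text \<open>The coefficients in \<open>R\<close> that a basis element of degree \<open>j\<close> can have in an element of degree \<open>d\<close>.\<close>

definition weight :: "int \<Rightarrow> int \<Rightarrow> 3 mpoly \<Rightarrow> bool" where
  "weight d j p \<longleftrightarrow> p = 0 \<or> (\<exists>k. d = j + int n * k \<and> form k p)"

lemma weight_0 [simp]: "weight d j 0"
  by (simp add: weight_def)

lemma weight_iff:
  "weight d j p \<longleftrightarrow> (if int n dvd d - j then form ((d - j) div int n) p else p = 0)"
proof -
  have "d = j + int n * k \<longleftrightarrow> int n dvd d - j \<and> k = (d - j) div int n" for k
    using degree_pos by (auto simp: dvd_def)
  then show ?thesis by (auto simp: weight_def)
qed

lemma subspace_weight: "subspace {p. weight d j p}"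
  by (cases "int n dvd d - j") (simp_all add: weight_iff subspace_form subspace_single_0)

lemma weight_add: "weight d j p \<Longrightarrow> weight d j q \<Longrightarrow> weight d j (p + q)"
  and weight_diff: "weight d j p \<Longrightarrow> weight d j q \<Longrightarrow> weight d j (p - q)"
  and weight_scaleR: "weight d j p \<Longrightarrow> weight d j (c *\<^sub>R p)"
  using subspace_weight[of d j] by (auto dest: subspace_add subspace_diff subspace_scale)

lemma weight_mult: "form e q \<Longrightarrow> weight (d - int n * e) j p \<Longrightarrow> weight d j (q * p)"
  unfolding weight_def
proof (elim disjE exE conjE)
  fix k assume "form e q" "form k p" "d - int n * e = j + int n * k"
  then show "q * p = 0 \<or> (\<exists>k. d = j + int n * k \<and> form k (q * p))"
    by (intro disjI2 exI[of _ "e + k"]) (auto simp: distrib_left intro: form_mult)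
qed simp

lemma weight_neg: "weight d j p \<Longrightarrow> d < j \<Longrightarrow> p = 0"
proof -
  assume "weight d j p" "d < j"
  then consider "p = 0" | k where "int n * k < 0" "form k p" by (auto simp: weight_def)
  then show "p = 0" by cases (auto simp: mult_less_0_iff form_neg)
qed

text \<open>Tagging basis elements by their degree spares any disjointness argument for the sets
  \<open>E j\<close>. Elements of degree above \<open>d\<close> cannot occur in a form of degree
  \<open>d\<close>, which justifies the truncation.\<close>

definition basis_upto :: "int \<Rightarrow> (int \<times> 3 mpoly) set" where
  "basis_upto d = Sigma {0..d} E"

lemma finite_basis_upto [simp]: "finite (basis_upto d)"
  by (simp add: basis_upto_def)

text \<open>All pairs are constrained, also those outside \<open>basis_upto d\<close>: coefficients
  at degrees above \<open>d\<close> are then forced to be zero, and expansions truncated at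
  different bounds agree.\<close>

definition admissible :: "int \<Rightarrow> (int \<times> 3 mpoly \<Rightarrow> 3 mpoly) \<Rightarrow> bool" where
  "admissible d r \<longleftrightarrow> (\<forall>k. weight d (fst k) (r k))"

definition expand :: "int \<Rightarrow> (int \<times> 3 mpoly \<Rightarrow> 3 mpoly) \<Rightarrow> 3 mpoly" where
  "expand d r = (\<Sum>k\<in>basis_upto d. snd k * \<phi> (r k))"

lemma expand_add: "expand d (\<lambda>k. r k + r' k) = expand d r + expand d r'"
  by (simp add: expand_def \<phi>_add distrib_left sum.distrib)

lemma expand_diff: "expand d (\<lambda>k. r k - r' k) = expand d r - expand d r'"
  by (simp add: expand_def \<phi>_diff right_diff_distrib sum_subtractf)

lemma expand_mult: "expand d (\<lambda>k. q * r k) = \<phi> q * expand d r"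
  by (simp add: expand_def \<phi>_mult sum_distrib_left mult_ac)

lemma expand_upto:
  assumes "admissible d' r" "d' \<le> d"
  shows "expand d r = expand d' r"
  unfolding expand_def
proof (rule sum.mono_neutral_right)
  show "\<forall>k\<in>basis_upto d - basis_upto d'. snd k * \<phi> (r k) = 0"
  proof
    fix k assume "k \<in> basis_upto d - basis_upto d'"
    then have "d' < fst k" by (auto simp: basis_upto_def)
    then have "r k = 0" using assms(1) weight_neg unfolding admissible_def by blast
    then show "snd k * \<phi> (r k) = 0" by simp
  qed
qed (use assms(2) in \<open>auto simp: basis_upto_def\<close>)

lemma form_weight: "weight d j p \<Longrightarrow> e \<in> E j \<Longrightarrow> form d (e * \<phi> p)"
  unfolding weight_def using form_mult[OF form_E form_\<phi>] by auto

lemma form_expand: "admissible d r \<Longrightarrow> form d (expand d r)"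
  unfolding expand_def admissible_def basis_upto_def
  by (intro form_sum) (auto intro!: form_weight)

lemma sum_basis_upto_top:
  assumes "\<And>k. k \<in> basis_upto d \<Longrightarrow> fst k \<noteq> d \<Longrightarrow> F k = 0" "d \<ge> 0"
  shows "sum F (basis_upto d) = (\<Sum>e\<in>E d. F (d, e))"
proof -
  have "sum F (basis_upto d) = sum F ({d} \<times> E d)"
  proof (rule sum.mono_neutral_right)
    show "\<forall>k\<in>basis_upto d - {d} \<times> E d. F k = 0"
      using assms(1) by (force simp: basis_upto_def)
  qed (use assms(2) in \<open>auto simp: basis_upto_def\<close>)
  also have "\<dots> = (\<Sum>e\<in>E d. F (d, e))"
    using sum.cartesian_product[of "\<lambda>a e. F (a, e)" "E d" "{d}"] by simp
  finally show ?thesis .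
qed

text \<open>A graded Nakayama argument: modulo the ideal a form is a combination of
  \<open>E d\<close>, and the cofactors of the remainder, of degree \<open>d - n\<close>, are
  expanded by induction.\<close>

lemma expand_surj: "form d p \<Longrightarrow> \<exists>r. admissible d r \<and> p = expand d r"
\<comment> \<open>The shift by one makes the measure drop also from \<open>d = 0\<close> to a
  negative degree.\<close>
proof (induction "nat (d + 1)" arbitrary: d p rule: less_induct)
  case less
  show ?case
  proof (cases "d < 0")
    case True
    then have "p = 0" using form_neg less.prems by blast
    then show ?thesis by (intro exI[of _ "\<lambda>_. 0"]) (simp add: admissible_def expand_def)
  next
    case False
    obtain c where c: "p - (\<Sum>e\<in>E d. c e *\<^sub>R e) \<in> I" using E_spans less.prems by blast
    let ?q = "p - (\<Sum>e\<in>E d. c e *\<^sub>R e)"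
    obtain a1 a2 a3 where a: "?q = a1 * f + a2 * g + a3 * h" using c unfolding ideal3_iff by blast
    have "form d ?q" by (intro form_diff form_sum form_scaleR less.prems form_E)
    then have "?q = hcomp d ?q" by (simp add: hcomp_form)
    also have "\<dots> = hcomp (d - n) a1 * f + hcomp (d - n) a2 * g + hcomp (d - n) a3 * h"
      unfolding a hcomp_add by (simp add: hcomp_mult_form[OF forms(1)]
          hcomp_mult_form[OF forms(2)] hcomp_mult_form[OF forms(3)])
    finally have q: "?q = hcomp (d - n) a1 * f + hcomp (d - n) a2 * g + hcomp (d - n) a3 * h" .
    have IH: "\<exists>r. admissible (d - n) r \<and> a = expand (d - n) r" if "form (d - n) a" for a
      using False degree_pos that by (intro less.hyps) auto
    obtain r1 r2 r3 where r: "admissible (d - n) r1" "admissible (d - n) r2" "admissible (d - n) r3"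
      "hcomp (d - n) a1 = expand d r1" "hcomp (d - n) a2 = expand d r2" "hcomp (d - n) a3 = expand d r3"
      using IH[OF form_hcomp, of a1] IH[OF form_hcomp, of a2] IH[OF form_hcomp, of a3]
        expand_upto[of "d - n" _ d] by auto
    define r0 where "r0 k = (if fst k = d then c (snd k) *\<^sub>R 1 else (0 :: 3 mpoly))" for k
    \<comment> \<open>Multiplying the coordinates of a cofactor by \<open>pvar 1\<close>,
      \<open>pvar 2\<close> or \<open>pvar 3\<close> amounts to multiplying the cofactor by f, g or
      h.\<close>
    let ?r = "\<lambda>k. ((r0 k + pvar 1 * r1 k) + pvar 2 * r2 k) + pvar 3 * r3 k"
    have "weight d (fst k) (r0 k)" for k
      by (auto simp: r0_def weight_def intro!: exI[of _ 0] form_scaleR form_1)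
    then have "admissible d ?r"
      using r(1-3) unfolding admissible_def
      by (auto intro!: weight_add weight_mult[OF form_pvar])
    moreover have "expand d r0 = (\<Sum>e\<in>E d. c e *\<^sub>R e)"
      using False unfolding expand_def
      by (subst sum_basis_upto_top) (auto simp: r0_def \<phi>_scaleR)
    then have "expand d ?r = p"
      using q unfolding expand_add expand_mult r by (simp add: algebra_simps)
    ultimately have "admissible d ?r \<and> p = expand d ?r" by simp
    then show ?thesis by (rule exI[of _ ?r])
  qed
qed

text \<open>
  Reducing a relation modulo the ideal shows that its coefficients lie in \<open>(u, v, w)\<close>. This gives a
  syzygy of \<open>f, g, h\<close> in degree \<open>d - n\<close>, which is a Koszul syzygy; expanding the latter in the basis and
  comparing coefficients in degree \<open>d - n\<close> makes the original coefficients a Koszul boundary of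
  \<open>(u, v, w)\<close>, so that they cancel.
\<close>

lemma expand_inj: "admissible d r \<Longrightarrow> expand d r = 0 \<Longrightarrow> k \<in> basis_upto d \<Longrightarrow> r k = 0"
proof (induction "nat d" arbitrary: d r k rule: less_induct)
  case less
  have "d \<ge> 0" using less.prems(3) by (auto simp: basis_upto_def)
  \<comment> \<open>A nonzero constant term can occur only at the top degree \<open>d\<close>, and
    the cofactors of the variables are coefficients for degree \<open>d - n\<close>.\<close>
  have "\<exists>c p1 p2 p3. r k = single 0 c + pvar 1 * p1 + pvar 2 * p2 + pvar 3 * p3 \<and> (c \<noteq> 0 \<longrightarrow> fst k = d)
      \<and> weight (d - n) (fst k) p1 \<and> weight (d - n) (fst k) p2 \<and> weight (d - n) (fst k) p3" for k
  proof (cases "r k = 0")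
    case True
    then show ?thesis by (intro exI[of _ 0]) simp
  next
    case False
    then obtain l where l: "d = fst k + int n * l" "form l (r k)"
      using less.prems(1) unfolding admissible_def weight_def by metis
    obtain c p1 p2 p3 where "r k = single 0 c + pvar 1 * p1 + pvar 2 * p2 + pvar 3 * p3" "c \<noteq> 0 \<longrightarrow> l = 0"
      "form (l - 1) p1" "form (l - 1) p2" "form (l - 1) p3"
      using form_decompose[OF l(2)] by blast
    moreover have "d - int n = fst k + int n * (l - 1)" using l(1) by (simp add: algebra_simps)
    ultimately show ?thesis using l(1) unfolding weight_def by (metis mult_zero_right add.right_neutral)
  qed
  then obtain c r1 r2 r3 where
    r: "\<And>k. r k = single 0 (c k) + pvar 1 * r1 k + pvar 2 * r2 k + pvar 3 * r3 k"
    and c: "\<And>k. c k \<noteq> 0 \<Longrightarrow> fst k = d"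
    and w: "admissible (d - n) r1" "admissible (d - n) r2" "admissible (d - n) r3"
    unfolding admissible_def by metis
  let ?P = "\<lambda>r. expand (d - n) r"
  have ext: "expand d s = ?P s" if "admissible (d - n) s" for s
    by (rule expand_upto[OF that]) simp
  have exp: "expand d r = expand d (\<lambda>k. single 0 (c k)) + f * ?P r1 + g * ?P r2 + h * ?P r3"
    using expand_add[of d] expand_mult[of d] ext w by (subst r[abs_def]) simp
  have "expand d (\<lambda>k. single 0 (c k)) = (\<Sum>e\<in>E d. snd (d, e) * \<phi> (single 0 (c (d, e))))"
    unfolding expand_def
  proof (rule sum_basis_upto_top)
    fix k :: "int \<times> 3 mpoly" assume "fst k \<noteq> d"
    then have "c k = 0" using c by blast
    then show "snd k * \<phi> (single 0 (c k)) = 0" by simp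
  qed fact
  also have "\<dots> = (\<Sum>e\<in>E d. c (d, e) *\<^sub>R e)"
    by (simp add: \<phi>_single)
  finally have top: "expand d (\<lambda>k. single 0 (c k)) = (\<Sum>e\<in>E d. c (d, e) *\<^sub>R e)" .
  have "(\<Sum>e\<in>E d. c (d, e) *\<^sub>R e) = (- ?P r1) * f + (- ?P r2) * g + (- ?P r3) * h"
    using exp less.prems(2) unfolding top by (simp add: algebra_simps eq_neg_iff_add_eq_0)
  then have "(\<Sum>e\<in>E d. c (d, e) *\<^sub>R e) \<in> I" unfolding ideal3_iff by blast
  from E_independent[OF this] have cd: "c (d, e) = 0" if "e \<in> E d" for e using that by blast
  have ck: "c k = 0" if "k \<in> basis_upto d" for k
  proof (rule ccontr)
    assume "c k \<noteq> 0"
    then have "fst k = d" by (rule c)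
    then have "k = (d, snd k)" "snd k \<in> E d" using that by (cases k; auto simp: basis_upto_def)+
    then show False using cd \<open>c k \<noteq> 0\<close> by metis
  qed
  have rel: "?P r1 * f + ?P r2 * g + ?P r3 * h = 0"
    using exp less.prems(2) cd unfolding top by (simp add: algebra_simps)
  obtain d1 d2 d3 where D: "form (d - n - n) d1" "form (d - n - n) d2" "form (d - n - n) d3"
    "?P r1 = d2 * h - d3 * g" "?P r2 = d3 * f - d1 * h" "?P r3 = d1 * g - d2 * f"
    by (rule koszul_forms[OF forms no_zeros rel form_expand[OF w(1)] form_expand[OF w(2)] form_expand[OF w(3)]])
  obtain s1 s2 s3 where s: "admissible (d - n - n) s1" "admissible (d - n - n) s2" "admissible (d - n - n) s3"
    "d1 = expand (d - n) s1" "d2 = expand (d - n) s2" "d3 = expand (d - n) s3"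
    using expand_surj[OF D(1)] expand_surj[OF D(2)] expand_surj[OF D(3)]
      expand_upto[of "d - n - n" _ "d - n"] by auto
  \<comment> \<open>The index \<open>k\<close> may belong to a degree above \<open>d - n\<close>;
    there the coefficient is zero by its weight alone.\<close>
  have IH: "q k = 0" if "admissible (d - n) q" "expand (d - n) q = 0" for q
  proof (cases "k \<in> basis_upto (d - n)")
    case True
    then have "d - n \<ge> 0" by (auto simp: basis_upto_def)
    then show ?thesis using less.hyps[of "d - n" q k] that degree_pos True by auto
  next
    case False
    then have "d - n < fst k" using less.prems(3) by (auto simp: basis_upto_def)
    then show ?thesis using that(1) weight_neg unfolding admissible_def by blast
  qed
  have uniq: "q k = pvar i * s k - pvar j * s' k"
    if "admissible (d - n) q" "admissible (d - n - n) s" "admissible (d - n - n) s'"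
      "expand (d - n) q = \<phi> (pvar i) * expand (d - n) s - \<phi> (pvar j) * expand (d - n) s'" for q s s' i j
  proof -
    have "admissible (d - n) (\<lambda>k. q k - (pvar i * s k - pvar j * s' k))"
      using that(1-3) unfolding admissible_def by (auto intro!: weight_diff weight_mult[OF form_pvar])
    moreover have "expand (d - n) (\<lambda>k. q k - (pvar i * s k - pvar j * s' k)) = 0"
      unfolding expand_diff expand_mult using that(4) by simp
    ultimately have "q k - (pvar i * s k - pvar j * s' k) = 0" by (rule IH)
    then show ?thesis by simp
  qed
  have "r1 k = pvar 3 * s2 k - pvar 2 * s3 k"
    by (rule uniq[OF w(1) s(2,3)]) (simp add: D(4) s(5,6)[symmetric] mult.commute)
  moreover have "r2 k = pvar 1 * s3 k - pvar 3 * s1 k"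
    by (rule uniq[OF w(2) s(3,1)]) (simp add: D(5) s(4,6)[symmetric] mult.commute)
  moreover have "r3 k = pvar 2 * s1 k - pvar 1 * s2 k"
    by (rule uniq[OF w(3) s(1,2)]) (simp add: D(6) s(4,5)[symmetric] mult.commute)
  ultimately have "r k = pvar 1 * (pvar 3 * s2 k - pvar 2 * s3 k) + pvar 2 * (pvar 1 * s3 k - pvar 3 * s1 k)
      + pvar 3 * (pvar 2 * s1 k - pvar 1 * s2 k)"
    using r[of k] ck[OF less.prems(3)] by simp
  then show ?case by (simp add: algebra_simps)
qed

end

subsection \<open>Hilbert functions\<close>

lemma card_monomials_3: "card {m :: 3 \<Rightarrow>\<^sub>0 nat. mdegree m = N} = (\<Sum>a\<le>N. Suc (N - a))"
proof -
  let ?S = "Sigma {..N} (\<lambda>a. {..N - a})"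
  let ?F = "\<lambda>(a, b). single 1 a + single 2 b + single 3 (N - a - b) :: 3 \<Rightarrow>\<^sub>0 nat"
  have "bij_betw ?F ?S {m. mdegree m = N}"
  proof (rule bij_betwI[where g = "\<lambda>m. (lookup m 1, lookup m 2)"])
    show "?F \<in> ?S \<rightarrow> {m. mdegree m = N}"
      by (auto simp: mdegree_3 lookup_add lookup_single)
    show "(\<lambda>m :: 3 \<Rightarrow>\<^sub>0 nat. (lookup m 1, lookup m 2)) \<in> {m. mdegree m = N} \<rightarrow> ?S"
      by (auto simp: mdegree_3)
    show "(lookup (?F x) 1, lookup (?F x) 2) = x" if "x \<in> ?S" for x
      by (cases x) (auto simp: lookup_add lookup_single)
    show "?F (lookup m 1, lookup m 2) = m" if "m \<in> {m. mdegree m = N}" for m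
    proof (rule poly_mapping_eqI)
      fix i :: 3
      have "i = 1 \<or> i = 2 \<or> i = 3" by (rule exhaust_3)
      then show "lookup (?F (lookup m 1, lookup m 2)) i = lookup m i"
        using that by (auto simp: mdegree_3 lookup_add lookup_single)
    qed
  qed
  then have "card {m :: 3 \<Rightarrow>\<^sub>0 nat. mdegree m = N} = card ?S"
    by (rule bij_betw_same_card[symmetric])
  then show ?thesis by simp
qed

lemma real_card_monomials_3:
  "real (card {m :: 3 \<Rightarrow>\<^sub>0 nat. mdegree m = N}) = (real N + 1) * (real N + 2) / 2"
proof -
  have "(\<Sum>a\<le>N. Suc (N - a)) = (\<Sum>a\<le>N. Suc a)"
    by (rule sum.reindex_bij_witness[of _ "\<lambda>a. N - a" "\<lambda>a. N - a"]) auto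
  moreover have "real (\<Sum>a\<le>N. Suc a) = (real N + 1) * (real N + 2) / 2"
    by (induction N) (auto simp: field_simps)
  ultimately show ?thesis by (simp only: card_monomials_3)
qed

definition form_dim :: "int \<Rightarrow> real" where
  "form_dim d = real (dim {p :: 3 mpoly. form d p})"

lemma form_dim_nonneg: "d \<ge> 0 \<Longrightarrow> form_dim d = (of_int d + 1) * (of_int d + 2) / 2"
proof -
  assume "d \<ge> 0"
  let ?K = "{m :: 3 \<Rightarrow>\<^sub>0 nat. mdegree m = nat d}"
  let ?v = "\<lambda>m. single m (1 :: real)"
  have fin: "finite ?K" by (rule finite_subset[OF _ finite_mdegree_le[of "nat d"]]) auto
  have "\<forall>m\<in>?K. c m = 0" if "(\<Sum>m\<in>?K. c m *\<^sub>R ?v m) = 0" for c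
  proof
    fix m assume m: "m \<in> ?K"
    have "lookup (\<Sum>m\<in>?K. c m *\<^sub>R ?v m) m = (\<Sum>k\<in>?K. if k = m then c k else 0)"
      by (simp add: lookup_sum lookup_single when_def if_distrib cong: if_cong)
    also have "\<dots> = c m" using m fin by (subst sum.delta) auto
    finally show "c m = 0" using that by simp
  qed
  note fam = independent_family[OF fin this]
  have "dim {p :: 3 mpoly. form d p} = card (?v ` ?K)"
  proof (rule dim_unique[OF _ _ fam(2) refl])
    show "?v ` ?K \<subseteq> {p. form d p}" using \<open>d \<ge> 0\<close> by (auto simp: form_single)
    show "{p :: 3 mpoly. form d p} \<subseteq> span (?v ` ?K)"
    proof clarify
      fix p :: "3 mpoly" assume p: "form d p"
      have "single m (lookup p m) \<in> span (?v ` ?K)" if "m \<in> keys p" for m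
        using that p unfolding single_scaleR[of m "lookup p m"]
        by (intro span_scale span_base) (auto simp: form_def)
      then have "(\<Sum>m\<in>keys p. single m (lookup p m)) \<in> span (?v ` ?K)" by (rule span_sum)
      then show "p \<in> span (?v ` ?K)" by (simp flip: poly_mapping_sum_single)
    qed
  qed
  also have "\<dots> = card ?K" by (rule card_image[OF fam(1)])
  finally show ?thesis using \<open>d \<ge> 0\<close> by (simp add: form_dim_def real_card_monomials_3)
qed

lemma lookup_sum_single:
  "finite A \<Longrightarrow> lookup (\<Sum>k\<in>A. single k (v k)) i = (if i \<in> A then v i else 0)"
  by (auto simp: lookup_sum lookup_single when_def sum.delta)

lemma keys_subset_iff: "keys F \<subseteq> A \<longleftrightarrow> (\<forall>k. k \<notin> A \<longrightarrow> lookup F k = 0)"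
  by (auto simp: in_keys_iff)

lemma subspace_difference_kernel: "subspace (difference_kernel \<Delta> a)"
proof -
  have s: "a dvd c *\<^sub>R p - c *\<^sub>R q" if "a dvd p - q" for a p q :: "3 mpoly" and c
  proof -
    have "c *\<^sub>R p - c *\<^sub>R q = single 0 c * (p - q)"
      by (simp add: scaleR_eq_single_times right_diff_distrib)
    then show ?thesis using that by simp
  qed
  have t: "a dvd p + p' - (q + q')" if "a dvd p - q" "a dvd p' - q'" for a p q p' q' :: "3 mpoly"
    using dvd_add[OF that] by (simp add: algebra_simps)
  show ?thesis
    unfolding subspace_def difference_kernel_def keys_subset_iff
    by (auto simp: lookup_add s t)
qed

lemma graded_part_finite_dim:
  assumes "finite A" "\<And>F. F \<in> W \<Longrightarrow> keys F \<subseteq> A" "\<And>F k. F \<in> W \<Longrightarrow> form d (lookup F k)"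
  shows "\<exists>Z. finite Z \<and> (W :: ('k \<Rightarrow>\<^sub>0 3 mpoly) set) \<subseteq> span Z"
proof -
  obtain Z where Z: "finite Z" "{p :: 3 mpoly. form d p} \<subseteq> span Z" using forms_finite_dim by blast
  let ?Z = "\<Union>k\<in>A. single k ` Z"
  have lin: "linear (single k :: 3 mpoly \<Rightarrow> _)" for k :: 'k
    by (rule linearI) (auto simp: single_add intro!: poly_mapping_eqI simp: lookup_single when_def)
  have "F \<in> span ?Z" if "F \<in> W" for F
  proof -
    have "single k (lookup F k) \<in> span ?Z" if "k \<in> keys F" for k
    proof -
      have "lookup F k \<in> span Z" using assms(3)[OF \<open>F \<in> W\<close>] Z by auto
      then have "single k (lookup F k) \<in> span (single k ` Z)"
        using linear_span_image[OF lin, of k Z] by blast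
      moreover have "single k ` Z \<subseteq> ?Z" using that assms(2)[OF \<open>F \<in> W\<close>] by auto
      ultimately show ?thesis using span_mono by blast
    qed
    then have "(\<Sum>k\<in>keys F. single k (lookup F k)) \<in> span ?Z" by (rule span_sum)
    then show ?thesis by (simp flip: poly_mapping_sum_single)
  qed
  then show ?thesis using Z(1) assms(1) by (intro exI[of _ ?Z]) auto
qed

lemma hilbert_function_neg: "0 \<in> N \<Longrightarrow> d < 0 \<Longrightarrow> hilbert_function N d = 0"
proof -
  assume "0 \<in> N" "d < 0"
  moreover have "F = 0" if "\<forall>k. form d (lookup F k)" for F :: "'a \<Rightarrow>\<^sub>0 3 mpoly"
  proof (rule poly_mapping_eqI)
    fix k
    show "lookup F k = lookup 0 k" using that \<open>d < 0\<close> form_neg[of d "lookup F k"] by simp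
  qed
  ultimately have "graded_part N d = {0}"
    by (auto simp: graded_part_def)
  then show ?thesis by (simp add: hilbert_function_def dim_zero_space)
qed

context net
begin

section \<open>Expansion of forms and splines, degree by degree\<close>

lemma sum_basis_upto_degree: "(\<Sum>k\<in>basis_upto d. F (fst k)) = (\<Sum>j\<in>{0..d}. real (quotient_dim f g h j) * F j)"
proof -
  have "(\<Sum>k\<in>basis_upto d. F (fst k)) = (\<Sum>j\<in>{0..d}. \<Sum>e\<in>E j. F j)"
    unfolding basis_upto_def by (subst sum.Sigma) (auto simp: split_def)
  then show ?thesis by (simp add: card_E)
qed

text \<open>The analogue for S itself: everything in it is explicit apart from
  \<open>quotient_dim\<close>, so it determines c_n.\<close>

lemma form_dim_expand:
  "form_dim d = (\<Sum>j\<in>{0..d}. real (quotient_dim f g h j) *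
     (if int n dvd d - j then form_dim ((d - j) div int n) else 0))"
proof -
  have "dim {p :: 3 mpoly. form d p} = (\<Sum>k\<in>basis_upto d. dim {p. weight d (fst k) p})"
  proof (rule dim_direct_sum[where T = "\<lambda>k p. snd k * \<phi> p"])
    fix k assume k: "k \<in> basis_upto d"
    show "linear (\<lambda>p. snd k * \<phi> p)"
      by (rule linearI) (auto simp: \<phi>_add \<phi>_scaleR distrib_left)
    show "subspace {p. weight d (fst k) p}" by (rule subspace_weight)
    show "\<exists>Z. finite Z \<and> {p. weight d (fst k) p} \<subseteq> span Z"
    proof -
      have "{p. weight d (fst k) p} \<subseteq> {p. form ((d - fst k) div int n) p}" by (auto simp: weight_iff split: if_splits)
      then show ?thesis using forms_finite_dim by (meson order_trans)
    qed
    show "snd k * \<phi> p \<in> {p. form d p}" if "p \<in> {p. weight d (fst k) p}" for p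
      using that k form_weight by (auto simp: basis_upto_def)
  next
    fix w assume w: "\<forall>k\<in>basis_upto d. w k \<in> {p. weight d (fst k) p}"
      "(\<Sum>k\<in>basis_upto d. snd k * \<phi> (w k)) = 0"
    let ?r = "\<lambda>k. if k \<in> basis_upto d then w k else 0"
    have "admissible d ?r" using w(1) by (auto simp: admissible_def)
    moreover have "expand d ?r = 0" using w(2) by (simp add: expand_def)
    ultimately have "?r k = 0" if "k \<in> basis_upto d" for k using expand_inj that by blast
    then show "\<forall>k\<in>basis_upto d. w k = 0" by auto
  next
    fix p :: "3 mpoly" assume "p \<in> {p. form d p}"
    then obtain r where "admissible d r" "p = expand d r" using expand_surj by blast
    then show "\<exists>w. (\<forall>k\<in>basis_upto d. w k \<in> {p. weight d (fst k) p}) \<and> p = (\<Sum>k\<in>basis_upto d. snd k * \<phi> (w k))"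
      by (intro exI[of _ r]) (auto simp: admissible_def expand_def)
  qed simp
  then have "form_dim d = (\<Sum>k\<in>basis_upto d. real (dim {p. weight d (fst k) p}))"
    by (simp add: form_dim_def)
  also have "\<dots> = (\<Sum>k\<in>basis_upto d. if int n dvd d - fst k then form_dim ((d - fst k) div int n) else 0)"
    by (intro sum.cong refl) (auto simp: form_dim_def weight_iff dim_zero_space)
  finally show ?thesis
    by (simp only: sum_basis_upto_degree[of "\<lambda>j. if int n dvd d - j then form_dim ((d - j) div int n) else 0"])
qed

text \<open>The conditions carry over in both directions because multiplication by
  \<open>b \<tau> = \<phi> (a \<tau>)\<close> acts on coordinates as multiplication by
  \<open>a \<tau>\<close>, and coordinates are unique.\<close>

lemma hilbert_function_expand:
  assumes fin: "finite (faces \<Delta>)"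
    and a: "\<And>\<tau>. \<tau> \<in> interior_edges \<Delta> \<Longrightarrow> form (int e) (a \<tau>)"
    and b: "\<And>\<tau>. \<tau> \<in> interior_edges \<Delta> \<Longrightarrow> b \<tau> = \<phi> (a \<tau>)"
  shows "real (hilbert_function (difference_kernel \<Delta> b) d) = (\<Sum>j\<in>{0..d}. real (quotient_dim f g h j) *
     (if int n dvd d - j then real (hilbert_function (difference_kernel \<Delta> a) ((d - j) div int n)) else 0))"
proof -
  let ?M = "difference_kernel \<Delta> b" and ?M' = "difference_kernel \<Delta> a"
  define W where "W j = {F \<in> ?M'. \<forall>\<sigma>. weight d j (lookup F \<sigma>)}" for j
  have dimW: "real (dim (W j)) = (if int n dvd d - j
      then real (hilbert_function ?M' ((d - j) div int n)) else 0)" for j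
  proof (cases "int n dvd d - j")
    case True
    then show ?thesis by (simp add: W_def hilbert_function_def graded_part_def weight_iff)
  next
    case False
    have "0 \<in> ?M'" using subspace_difference_kernel subspace_0 by blast
    then have "W j = {0}" using False by (auto simp: W_def weight_iff intro!: poly_mapping_eqI)
    then show ?thesis using False by (simp add: dim_zero_space)
  qed
  define T where "T k F = Poly_Mapping.map (\<lambda>p. snd k * \<phi> p) F"
    for k :: "int \<times> 3 mpoly" and F :: "(real ^ 2) set \<Rightarrow>\<^sub>0 3 mpoly"
  have T: "lookup (T k F) \<sigma> = snd k * \<phi> (lookup F \<sigma>)" for k F \<sigma>
    by (simp add: T_def map.rep_eq when_def)
  have "dim (graded_part ?M d) = (\<Sum>k\<in>basis_upto d. dim (W (fst k)))"
  proof (rule dim_direct_sum[where T = T])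
    fix k assume k: "k \<in> basis_upto d"
    show "linear (T k)"
      by (rule linearI; rule poly_mapping_eqI) (auto simp: T lookup_add \<phi>_add \<phi>_scaleR distrib_left)
    show "subspace (W (fst k))"
      using subspace_difference_kernel[of \<Delta> a]
      by (auto simp: W_def subspace_def lookup_add weight_add weight_scaleR)
    have form_W: "form ((d - fst k) div int n) (lookup F \<sigma>)" if "F \<in> W (fst k)" for F \<sigma>
      using that by (auto simp: W_def weight_iff split: if_splits)
    show "\<exists>Z. finite Z \<and> W (fst k) \<subseteq> span Z"
      by (rule graded_part_finite_dim[OF fin _ form_W]) (auto simp: W_def difference_kernel_def)
    show "T k F \<in> graded_part ?M d" if F: "F \<in> W (fst k)" for F
    proof -
      have "form d (lookup (T k F) \<sigma>)" for \<sigma>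
      proof -
        have "weight d (fst k) (lookup F \<sigma>)" using F by (simp add: W_def)
        then show ?thesis using k form_weight unfolding T by (auto simp: basis_upto_def)
      qed
      moreover have "b \<tau> dvd lookup (T k F) \<sigma> - lookup (T k F) \<sigma>'"
        if \<tau>: "\<tau> \<in> interior_edges \<Delta>" and dvd: "a \<tau> dvd lookup F \<sigma> - lookup F \<sigma>'" for \<tau> \<sigma> \<sigma>'
      proof -
        obtain q where "lookup F \<sigma> - lookup F \<sigma>' = a \<tau> * q" using dvd by (elim dvdE)
        then have "lookup (T k F) \<sigma> - lookup (T k F) \<sigma>' = b \<tau> * (snd k * \<phi> q)"
          unfolding T right_diff_distrib[symmetric] \<phi>_diff[symmetric] by (simp add: \<phi>_mult b[OF \<tau>] mult_ac)
        then show ?thesis by simp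
      qed
      ultimately show ?thesis
        using F unfolding W_def graded_part_def difference_kernel_def keys_subset_iff by (auto simp: T)
    qed
  next
    fix w assume w: "\<forall>k\<in>basis_upto d. w k \<in> W (fst k)" "(\<Sum>k\<in>basis_upto d. T k (w k)) = 0"
    have "lookup (w k) \<sigma> = 0" if k: "k \<in> basis_upto d" for k \<sigma>
    proof -
      let ?r = "\<lambda>k. if k \<in> basis_upto d then lookup (w k) \<sigma> else 0"
      have "admissible d ?r" using w(1) by (auto simp: admissible_def W_def)
      moreover have "lookup (\<Sum>k\<in>basis_upto d. T k (w k)) \<sigma> = 0" using w(2) by simp
      then have "expand d ?r = 0" by (simp add: expand_def lookup_sum T)
      ultimately have "?r k = 0" using expand_inj k by blast
      then show ?thesis using k by simp
    qed
    then show "\<forall>k\<in>basis_upto d. w k = 0" by (auto intro: poly_mapping_eqI)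
  next
    fix F assume "F \<in> graded_part ?M d"
    then have F: "F \<in> ?M" "\<And>\<sigma>. form d (lookup F \<sigma>)" by (auto simp: graded_part_def)
    have "\<exists>r. admissible d r \<and> lookup F \<sigma> = expand d r" for \<sigma> using expand_surj F(2) by blast
    then obtain r where r: "\<And>\<sigma>. admissible d (r \<sigma>)" "\<And>\<sigma>. lookup F \<sigma> = expand d (r \<sigma>)" by metis
    \<comment> \<open>The coordinates of all faces at the basis element \<open>k\<close> are
      reassembled into one tuple over the faces.\<close>
    define w where "w k = (\<Sum>\<sigma>\<in>faces \<Delta>. single \<sigma> (r \<sigma> k))" for k
    have w: "lookup (w k) \<sigma> = (if \<sigma> \<in> faces \<Delta> then r \<sigma> k else 0)" for k \<sigma>
      by (simp add: w_def lookup_sum_single fin)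
    have "w k \<in> W (fst k)" if k: "k \<in> basis_upto d" for k
    proof -
      have "a \<tau> dvd r \<sigma> k - r \<sigma>' k"
        if \<tau>: "\<tau> \<in> interior_edges \<Delta>" and dvd: "b \<tau> dvd lookup F \<sigma> - lookup F \<sigma>'" for \<tau> \<sigma> \<sigma>'
      proof -
        obtain q where q: "lookup F \<sigma> - lookup F \<sigma>' = q * \<phi> (a \<tau>)"
          using dvd b[OF \<tau>] by (metis dvdE mult.commute)
        have fa: "form (int n * int e) (\<phi> (a \<tau>))" by (rule form_\<phi>[OF a[OF \<tau>]])
        have "lookup F \<sigma> - lookup F \<sigma>' = hcomp d (lookup F \<sigma> - lookup F \<sigma>')"
          by (simp add: hcomp_form[OF form_diff[OF F(2) F(2)]])
        also have "\<dots> = hcomp (d - int n * int e) q * \<phi> (a \<tau>)"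
          unfolding q by (rule hcomp_mult_form[OF fa])
        finally have eq: "lookup F \<sigma> - lookup F \<sigma>' = hcomp (d - int n * int e) q * \<phi> (a \<tau>)" .
        \<comment> \<open>The quotient is expanded as well; comparing coordinates then yields
          \<open>a \<tau> * s k\<close> as the difference at \<open>k\<close>.\<close>
        obtain s where s: "admissible (d - int n * int e) s" "hcomp (d - int n * int e) q = expand (d - int n * int e) s"
          using expand_surj[OF form_hcomp] by blast
        have s': "expand (d - int n * int e) s = expand d s"
          by (rule expand_upto[OF s(1), symmetric]) simp
        have "admissible d (\<lambda>k. (r \<sigma> k - r \<sigma>' k) - a \<tau> * s k)"
          using r(1) s(1) unfolding admissible_def
          by (auto intro!: weight_diff weight_mult[OF a[OF \<tau>]])
        moreover have "expand d (\<lambda>k. (r \<sigma> k - r \<sigma>' k) - a \<tau> * s k) = 0"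
          unfolding expand_diff expand_mult r(2)[symmetric] eq s(2) s' by (simp add: mult.commute)
        ultimately have "(r \<sigma> k - r \<sigma>' k) - a \<tau> * s k = 0" using expand_inj k by blast
        then show ?thesis by simp
      qed
      moreover have "weight d (fst k) (r \<sigma> k)" for \<sigma>
        using r(1) unfolding admissible_def by blast
      ultimately show ?thesis
        using F(1)
        unfolding W_def difference_kernel_def keys_subset_iff by (auto simp: w)
    qed
    moreover have "F = (\<Sum>k\<in>basis_upto d. T k (w k))"
    proof (rule poly_mapping_eqI)
      fix \<sigma>
      have "lookup F \<sigma> = (\<Sum>k\<in>basis_upto d. snd k * \<phi> (lookup (w k) \<sigma>))"
      proof (cases "\<sigma> \<in> faces \<Delta>")
        case True
        then show ?thesis by (simp add: w r(2) expand_def)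
      next
        case False
        then show ?thesis using F(1) by (simp add: w difference_kernel_def keys_subset_iff)
      qed
      then show "lookup F \<sigma> = lookup (\<Sum>k\<in>basis_upto d. T k (w k)) \<sigma>" by (simp add: lookup_sum T)
    qed
    ultimately show "\<exists>w. (\<forall>k\<in>basis_upto d. w k \<in> W (fst k)) \<and> F = (\<Sum>k\<in>basis_upto d. T k (w k))" by blast
  qed simp
  then have "real (hilbert_function ?M d) = (\<Sum>k\<in>basis_upto d. real (dim (W (fst k))))"
    by (simp add: hilbert_function_def)
  also have "\<dots> = (\<Sum>j\<in>{0..d}. real (quotient_dim f g h j) * real (dim (W j)))"
    by (rule sum_basis_upto_degree)
  finally show ?thesis by (simp only: dimW)
qed

end

section \<open>Restriction to a residue class of degrees\<close>

lemma sum_residue_class: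
  fixes c F :: "int \<Rightarrow> real"
  assumes "e < n"
  shows "(\<Sum>j\<in>{0..int (n * K + e)}. c j *
      (if int n dvd int (n * K + e) - j then F ((int (n * K + e) - j) div int n) else 0))
    = (\<Sum>i\<le>K. c (int (e + n * i)) * F (int K - int i))"
proof -
  let ?t = "\<lambda>j. c j * (if int n dvd int (n * K + e) - j then F ((int (n * K + e) - j) div int n) else 0)"
  let ?v = "\<lambda>i. int (e + n * i)"
  have n: "n > 0" using assms by simp
  have inj: "inj_on ?v {..K}" using n by (auto intro: inj_onI)
  have "sum ?t {0..int (n * K + e)} = sum ?t (?v ` {..K})"
  proof (rule sum.mono_neutral_right)
    show "?v ` {..K} \<subseteq> {0..int (n * K + e)}"
      using n by (auto simp flip: of_nat_mult)
    show "\<forall>j\<in>{0..int (n * K + e)} - ?v ` {..K}. ?t j = 0"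
    proof
      fix j assume j: "j \<in> {0..int (n * K + e)} - ?v ` {..K}"
      have "\<not> int n dvd int (n * K + e) - j"
      proof
        assume "int n dvd int (n * K + e) - j"
        then obtain q where q: "int (n * K + e) - j = int n * q" by (elim dvdE)
        have "int n * q \<ge> 0" using q j by auto
        then have "q \<ge> 0" using n by (simp add: zero_le_mult_iff)
        have je: "j = int n * (int K - q) + int e" using q by (simp add: algebra_simps)
        \<comment> \<open>The extra 1 absorbs the remainder: \<open>j \<ge> 0\<close> and
          \<open>e < n\<close> only show that \<open>int n * (int K - q)\<close> exceeds
          \<open>- int n\<close>.\<close>
        have "int n * (int K - q + 1) > 0" using je j assms by (simp add: algebra_simps)
        then have "q \<le> int K" using n by (simp add: zero_less_mult_iff)
        then have "j = ?v (nat (int K - q))" using je by simp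
        moreover have "nat (int K - q) \<in> {..K}" using \<open>q \<ge> 0\<close> by simp
        ultimately show False using j by blast
      qed
      then show "?t j = 0" by simp
    qed
  qed simp
  also have "\<dots> = (\<Sum>i\<le>K. ?t (?v i))" by (rule sum.reindex[OF inj, unfolded comp_def])
  also have "\<dots> = (\<Sum>i\<le>K. c (?v i) * F (int K - int i))"
  proof (rule sum.cong)
    fix i
    have "int (n * K + e) - ?v i = int n * (int K - int i)" by (simp add: algebra_simps)
    then show "?t (?v i) = c (?v i) * F (int K - int i)" using n by simp
  qed simp
  finally show ?thesis .
qed

text \<open>Convolution with the binomials \<open>(k+1)(k+2)/2\<close> is inverted by the third difference, and the
  third difference of a quadratic polynomial vanishes.\<close>

lemma deconvolve_quadratic:
  fixes x :: "nat \<Rightarrow> real" and N e :: real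
  defines "y \<equiv> \<lambda>k. (N * k + e + 1) * (N * k + e + 2) / 2"
  assumes y: "\<And>K. y (real K) = (\<Sum>i\<le>K. x i * ((real K - real i + 1) * (real K - real i + 2) / 2))"
  shows "x 0 = y 0" "x 1 = y 1 - 3 * y 0" "x 2 = y 2 - 3 * y 1 + 3 * y 0" "i \<ge> 3 \<Longrightarrow> x i = 0"
proof -
  show x0: "x 0 = y 0" using y[of 0] by simp
  have "y 1 = 3 * x 0 + x 1" using y[of 1] by (simp add: numeral_eq_Suc)
  then show x1: "x 1 = y 1 - 3 * y 0" using x0 by simp
  have "y 2 = 6 * x 0 + 3 * x 1 + x 2" using y[of 2] by (simp add: numeral_eq_Suc)
  then show x2: "x 2 = y 2 - 3 * y 1 + 3 * y 0" using x0 x1 by simp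
  show "i \<ge> 3 \<Longrightarrow> x i = 0"
  proof (induction i rule: less_induct)
    case (less K)
    let ?t = "\<lambda>i. x i * ((real K - real i + 1) * (real K - real i + 2) / 2)"
    \<comment> \<open>By induction all terms strictly between 2 and \<open>K\<close> are zero, and
      \<open>x K\<close> has coefficient 1, so the equation can be solved for it.\<close>
    have "(\<Sum>i\<le>K. ?t i) = (\<Sum>i\<in>{0, 1, 2, K}. ?t i)"
      using less by (intro sum.mono_neutral_right) auto
    also have "\<dots> = ?t 0 + (?t 1 + (?t 2 + ?t K))"
      using less.prems by simp
    finally have "x K = y (real K) - ?t 0 - ?t 1 - ?t 2" using y[of K] by simp
    then show "x K = 0" unfolding x0 x1 x2 y_def by (simp add: field_simps)
  qed
qed

context net
begin

text \<open>For \<open>e < n\<close> the numbers \<open>c0 e\<close>, \<open>c1 e\<close>,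
  \<open>c2 e\<close> are c_n(e), c_n(e + n), c_n(e + 2n): the first three values of the third
  difference, with step n, of the dimensions (j + 1)(j + 2)/2 extended by zero.\<close>

definition c0 :: "nat \<Rightarrow> real" where
  "c0 e = (real e + 1) * (real e + 2) / 2"
definition c1 :: "nat \<Rightarrow> real" where
  "c1 e = (real n + real e + 1) * (real n + real e + 2) / 2 - 3 * c0 e"
definition c2 :: "nat \<Rightarrow> real" where
  "c2 e = (2 * real n + real e + 1) * (2 * real n + real e + 2) / 2
     - 3 * ((real n + real e + 1) * (real n + real e + 2) / 2) + 3 * c0 e"

lemma quotient_dim_residue:
  assumes "e < n"
  shows "real (quotient_dim f g h (int e)) = c0 e"
    "real (quotient_dim f g h (int (e + n))) = c1 e"
    "real (quotient_dim f g h (int (e + n * 2))) = c2 e"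
    "i \<ge> 3 \<Longrightarrow> real (quotient_dim f g h (int (e + n * i))) = 0"
proof -
  let ?x = "\<lambda>i. real (quotient_dim f g h (int (e + n * i)))"
  have *: "(real n * real K + real e + 1) * (real n * real K + real e + 2) / 2
      = (\<Sum>i\<le>K. ?x i * ((real K - real i + 1) * (real K - real i + 2) / 2))" for K
  proof -
    have "(real n * real K + real e + 1) * (real n * real K + real e + 2) / 2 = form_dim (int (n * K + e))"
      by (simp add: form_dim_nonneg)
    also have "\<dots> = (\<Sum>i\<le>K. ?x i * form_dim (int K - int i))"
      by (subst form_dim_expand) (rule sum_residue_class[OF assms])
    also have "\<dots> = (\<Sum>i\<le>K. ?x i * ((real K - real i + 1) * (real K - real i + 2) / 2))"
      by (intro sum.cong) (auto simp: form_dim_nonneg)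
    finally show ?thesis .
  qed
  note x = deconvolve_quadratic[where x = ?x and N = "real n" and e = "real e", OF *]
  show "real (quotient_dim f g h (int e)) = c0 e"
    "real (quotient_dim f g h (int (e + n))) = c1 e"
    "real (quotient_dim f g h (int (e + n * 2))) = c2 e"
    using x(1-3) by (simp_all add: c0_def c1_def c2_def mult.commute)
  show "i \<ge> 3 \<Longrightarrow> ?x i = 0" by (rule x(4))
qed

text \<open>Hilbert functions vanish in negative degrees, so the three-term formula has no boundary
  cases and holds for every integer \<open>K\<close>.\<close>

lemma hilbert_function_residue:
  assumes "finite (faces \<Delta>)" "\<And>\<tau>. \<tau> \<in> interior_edges \<Delta> \<Longrightarrow> form (int k) (a \<tau>)"
    and "\<And>\<tau>. \<tau> \<in> interior_edges \<Delta> \<Longrightarrow> b \<tau> = \<phi> (a \<tau>)" and e: "e < n"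
  defines "H \<equiv> \<lambda>d. real (hilbert_function (difference_kernel \<Delta> a) d)"
  shows "real (hilbert_function (difference_kernel \<Delta> b) (int n * K + int e))
    = c0 e * H K + c1 e * H (K - 1) + c2 e * H (K - 2)"
proof -
  have H_neg: "H d = 0" if "d < 0" for d
    unfolding H_def using hilbert_function_neg[OF subspace_0[OF subspace_difference_kernel] that] by simp
  show ?thesis
  proof (cases "K < 0")
    case True
    have "int n * K + int e < 0"
    proof -
      have "int n * K \<le> int n * (-1)" using True by (intro mult_left_mono) auto
      then show ?thesis using e by simp
    qed
    then show ?thesis
      using hilbert_function_neg[OF subspace_0[OF subspace_difference_kernel]] H_neg True by simp
  next
    case False
    then obtain L where L: "K = int L" by (metis nonneg_int_cases not_less)
    let ?x = "\<lambda>i. real (quotient_dim f g h (int (e + n * i)))"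
    have "real (hilbert_function (difference_kernel \<Delta> b) (int (n * L + e)))
        = (\<Sum>j\<in>{0..int (n * L + e)}. real (quotient_dim f g h j) *
            (if int n dvd int (n * L + e) - j then H ((int (n * L + e) - j) div int n) else 0))"
      unfolding H_def by (rule hilbert_function_expand[OF assms(1)]) (fact assms(2,3))+
    also have "\<dots> = (\<Sum>i\<le>L. ?x i * H (int L - int i))"
      by (rule sum_residue_class[OF e])
    also have "\<dots> = (\<Sum>i\<in>{0, 1, 2}. ?x i * H (int L - int i))"
    proof -
      have "(\<Sum>i\<le>L. ?x i * H (int L - int i)) = (\<Sum>i\<in>{..L} \<union> {0, 1, 2}. ?x i * H (int L - int i))"
        using H_neg by (intro sum.mono_neutral_left) auto
      also have "\<dots> = (\<Sum>i\<in>{0, 1, 2}. ?x i * H (int L - int i))"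
      proof (rule sum.mono_neutral_right)
        show "\<forall>i\<in>{..L} \<union> {0, 1, 2} - {0, 1, 2}. ?x i * H (int L - int i) = 0"
        proof
          fix i assume "i \<in> {..L} \<union> {0, 1, 2} - {0, 1, 2}"
          then have "i \<ge> 3" by auto
          then show "?x i * H (int L - int i) = 0" using quotient_dim_residue(4)[OF e] by simp
        qed
      qed auto
      finally show ?thesis .
    qed
    finally show ?thesis
      using quotient_dim_residue(1-3)[OF e] by (simp add: L)
  qed
qed

text \<open>The closed form turns the formulas for B and C into identities between rational
  functions of n.\<close>

lemma quotient_dim_2n: "real (quotient_dim f g h (2 * int n)) = (real n - 1) * (real n - 2) / 2"
proof -
  have "real (quotient_dim f g h (2 * int n)) = c2 0"
    using quotient_dim_residue(3)[OF degree_pos] by (simp add: mult.commute)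
  then show ?thesis by (simp add: c2_def c0_def field_simps)
qed

text \<open>This and the next lemma express that c_n is zero above degree 3n - 3: e + n exceeds it
  only for n = 1, and e + 2n exactly when n \<le> e + 2. They are the source of the -3 in the
  postulation bound.\<close>

lemma c1_vanishes: "n = 1 \<Longrightarrow> e < n \<Longrightarrow> c1 e = 0"
  unfolding c1_def c0_def by auto

lemma c2_vanishes: "e < n \<Longrightarrow> n \<le> e + 2 \<Longrightarrow> c2 e = 0"
proof -
  assume "e < n" "n \<le> e + 2"
  then have "n = e + 1 \<or> n = e + 2" by linarith
  then have "real n = real e + 1 \<or> real n = real e + 2" by auto
  then show ?thesis unfolding c2_def c0_def by (elim disjE) (simp_all add: field_simps)
qed

section \<open>Linear forms of the edges\<close>

lemma linear_relation:
  assumes "d1 *\<^sub>R f + d2 *\<^sub>R g + d3 *\<^sub>R h = 0"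
  shows "d1 = 0" "d2 = 0" "d3 = 0"
proof -
  let ?u = "\<lambda>x. if x = f then d1 else if x = g then d2 else d3"
  have ne: "f \<noteq> g" "f \<noteq> h" "g \<noteq> h" "g \<noteq> f" "h \<noteq> f" "h \<noteq> g" using distinct by auto
  have 0: "(\<Sum>x\<in>{f, g, h}. ?u x *\<^sub>R x) = 0" using assms by (simp add: add.assoc ne)
  have "?u x = 0" if "x \<in> {f, g, h}" for x
    by (rule independentD[OF independent _ order_refl 0 that]) simp
  from this[of f] this[of g] this[of h] show "d1 = 0" "d2 = 0" "d3 = 0" by (simp_all add: ne)
qed

lemma \<phi>_inj_linear:
  assumes "form 1 p" "\<phi> p = 0"
  shows "p = 0"
proof -
  obtain c p1 p2 p3 where p: "p = single 0 c + pvar 1 * p1 + pvar 2 * p2 + pvar 3 * p3" "c = 0"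
    and pi: "form 0 p1" "form 0 p2" "form 0 p3"
    using form_decompose[OF assms(1)] by auto
  obtain d1 d2 d3 where d: "p1 = d1 *\<^sub>R 1" "p2 = d2 *\<^sub>R 1" "p3 = d3 *\<^sub>R 1"
    using form_0_constant pi by blast
  have "d1 *\<^sub>R f + d2 *\<^sub>R g + d3 *\<^sub>R h = 0"
    using assms(2) by (simp add: p d \<phi>_add \<phi>_scaleR)
  then show ?thesis using linear_relation[of d1 d2 d3] by (simp add: p d)
qed

text \<open>Uniqueness, required by the definite description in \<open>line_of\<close>, is
  injectivity of the pullback on linear forms.\<close>

lemma line_of:
  assumes "G \<in> span {f, g, h}"
  shows "form 1 (line_of f g h G)" "\<phi> (line_of f g h G) = G"
proof -
  obtain u where u: "G = (\<Sum>x\<in>{f, g, h}. u x *\<^sub>R x)"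
    using assms span_finite[of "{f, g, h}"] by auto
  let ?l = "u f *\<^sub>R pvar 1 + u g *\<^sub>R pvar 2 + u h *\<^sub>R pvar 3 :: 3 mpoly"
  have l: "form 1 ?l" by (intro form_add form_scaleR form_pvar)
  have l': "\<phi> ?l = G" using distinct by (simp add: u \<phi>_add \<phi>_scaleR add.assoc)
  have "\<exists>!l. form 1 l \<and> \<phi> l = G"
  proof (rule ex1I[of _ ?l])
    fix l assume "form 1 l \<and> \<phi> l = G"
    then have "form 1 (l - ?l)" "\<phi> (l - ?l) = 0"
      using l l' by (auto simp: \<phi>_diff intro: form_diff)
    then have "l - ?l = 0" by (rule \<phi>_inj_linear)
    then show "l = ?l" by simp
  qed (use l l' in blast)
  then have "form 1 (line_of f g h G) \<and> \<phi> (line_of f g h G) = G"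
    unfolding line_of_def by (rule theI')
  then show "form 1 (line_of f g h G)" "\<phi> (line_of f g h G) = G" by auto
qed

end

subsection \<open>Hilbert polynomials and postulation numbers\<close>

lemma hilbert_poly_unique:
  assumes "has_hilbert_poly N P"
  shows "hilbert_poly N = P"
  unfolding hilbert_poly_def
proof (rule the_equality)
  fix Q assume "has_hilbert_poly N Q"
  then have "\<forall>\<^sub>F d :: int in at_top. poly (Q - P) (of_int d) = 0"
    using assms unfolding has_hilbert_poly_def by eventually_elim simp
  then obtain B where B: "\<And>d :: int. d \<ge> B \<Longrightarrow> poly (Q - P) (of_int d) = 0"
    by (auto simp: eventually_at_top_linorder)
  have "of_int ` {B..} \<subseteq> {x. poly (Q - P) x = 0}" using B by auto
  moreover have "infinite ((of_int :: int \<Rightarrow> real) ` {B..})"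
    by (subst finite_image_iff) (auto simp: inj_on_def infinite_Ici)
  ultimately have "infinite {x. poly (Q - P) x = 0}" using finite_subset by blast
  then show "Q = P" using poly_roots_finite[of "Q - P"] by auto
qed (rule assms)

lemma Greatest_int:
  fixes Q :: "int \<Rightarrow> bool"
  assumes "Q k" "\<And>y. Q y \<Longrightarrow> y \<le> B"
  shows "Q (Greatest Q)" "Q y \<Longrightarrow> y \<le> Greatest Q"
proof -
  let ?S = "{y. Q y \<and> k \<le> y}"
  have fin: "finite ?S" by (rule finite_subset[of _ "{k..B}"]) (use assms in auto)
  have "Max ?S \<in> ?S" using fin assms(1) by (intro Max_in) auto
  moreover have le: "y \<le> Max ?S" if "Q y" for y
  proof (cases "k \<le> y")
    case True
    then show ?thesis using fin that by (intro Max_ge) auto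
  next
    case False
    then show ?thesis using calculation by auto
  qed
  ultimately have "Greatest Q = Max ?S" by (intro Greatest_equality) auto
  then show "Q (Greatest Q)" "Q y \<Longrightarrow> y \<le> Greatest Q" using \<open>Max ?S \<in> ?S\<close> le by auto
qed

text \<open>A greatest disagreement exists: agreement everywhere would make \<open>P\<close> vanish
  at all negative integers, hence be zero, against the nonzero value in degree zero.\<close>

lemma postulation_number:
  assumes P: "has_hilbert_poly N P" and "0 \<in> N" and "hilbert_function N 0 \<noteq> 0"
  defines "p \<equiv> postulation_number N"
  shows "real (hilbert_function N p) \<noteq> poly P (of_int p)"
    "d > p \<Longrightarrow> real (hilbert_function N d) = poly P (of_int d)"
proof -
  let ?Q = "\<lambda>d. real (hilbert_function N d) \<noteq> poly P (of_int d)"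
  have p: "p = Greatest ?Q"
    by (simp add: p_def postulation_number_def hilbert_poly_unique[OF P])
  have "\<exists>k. ?Q k"
  proof (rule ccontr)
    assume "\<not> ?thesis"
    then have eq: "real (hilbert_function N d) = poly P (of_int d)" for d by blast
    have "of_int ` {..<0} \<subseteq> {x. poly P x = 0}"
      using hilbert_function_neg[OF \<open>0 \<in> N\<close>] eq by (auto simp flip: eq)
    moreover have "infinite ((of_int :: int \<Rightarrow> real) ` {..<0})"
      by (subst finite_image_iff) (auto simp: inj_on_def infinite_Iio)
    ultimately have "infinite {x. poly P x = 0}" using finite_subset by blast
    then have "P = 0" using poly_roots_finite by blast
    then show False using eq[of 0] assms(3) by simp
  qed
  then obtain k where k: "?Q k" ..
  obtain B where B: "\<And>d. d \<ge> B \<Longrightarrow> \<not> ?Q d"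
    using P by (auto simp: has_hilbert_poly_def eventually_at_top_linorder)
  then have B': "y \<le> B" if "?Q y" for y using that by (meson linear)
  show "?Q p" unfolding p by (rule Greatest_int(1)[of ?Q, OF k B'])
  show "d > p \<Longrightarrow> real (hilbert_function N d) = poly P (of_int d)"
    using Greatest_int(2)[of ?Q, OF k B', of d] unfolding p by auto
qed

text \<open>The constant spline 1 lies in degree zero. This supplies the nonvanishing needed for
  \<open>postulation_number\<close>.\<close>

lemma hilbert_function_difference_kernel_0:
  assumes "finite (faces \<Delta>)" "faces \<Delta> \<noteq> {}"
  shows "hilbert_function (difference_kernel \<Delta> a) 0 \<noteq> 0"
proof
  let ?V = "graded_part (difference_kernel \<Delta> a) 0"
  assume 0: "hilbert_function (difference_kernel \<Delta> a) 0 = 0"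
  define F where "F = (\<Sum>\<sigma>\<in>faces \<Delta>. single \<sigma> (1 :: 3 mpoly))"
  have F: "lookup F \<sigma> = (if \<sigma> \<in> faces \<Delta> then 1 else 0)" for \<sigma>
    by (simp add: F_def lookup_sum_single assms(1))
  have FV: "F \<in> ?V"
    by (auto simp: graded_part_def difference_kernel_def keys_subset_iff F form_1)
  have sub: "subspace ?V"
    using subspace_difference_kernel[of \<Delta> a]
    by (auto simp: graded_part_def subspace_def lookup_add form_add form_scaleR)
  \<comment> \<open>As \<open>dim\<close> is also 0 on infinite-dimensional spaces, these have to be
    excluded before the space can be called trivial.\<close>
  have "\<exists>Z. finite Z \<and> ?V \<subseteq> span Z"
    by (rule graded_part_finite_dim[OF assms(1), where d = 0]) (auto simp: graded_part_def difference_kernel_def)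
  then obtain Z where Z: "finite Z" "?V \<subseteq> span Z" by blast
  obtain B where B: "finite B" "span B = ?V" "card B = dim ?V"
    by (rule finite_basis[OF sub Z])
  then have "B = {}" using 0 by (simp add: hilbert_function_def)
  then have "?V = {0}" using B(2) by simp
  then have "F = 0" using FV by blast
  moreover obtain \<sigma> where "\<sigma> \<in> faces \<Delta>" using assms(2) by blast
  ultimately show False using F[of \<sigma>] by simp
qed

lemma mesh_faces:
  assumes "mesh \<Delta>"
  shows "finite (faces \<Delta>)" "faces \<Delta> \<noteq> {}"
proof -
  show "finite (faces \<Delta>)" using assms by (simp add: mesh_def plane_cell_complex_def)
  have *: "\<forall>v\<in>verts \<Delta>. \<exists>\<sigma>\<in>faces \<Delta>. v \<in> frontier \<sigma>"
    "\<forall>\<tau>\<in>edges \<Delta>. \<exists>\<sigma>\<in>faces \<Delta>. \<tau> \<subseteq> frontier \<sigma>"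
    "support \<Delta> \<noteq> {}"
    using assms by (simp_all add: mesh_def)
  from *(3) have "cells \<Delta> \<noteq> {}" by (auto simp: support_def)
  then have "verts \<Delta> \<noteq> {} \<or> edges \<Delta> \<noteq> {} \<or> faces \<Delta> \<noteq> {}" by (auto simp: cells_def)
  then show "faces \<Delta> \<noteq> {}" using *(1,2) by blast
qed

theorem corollary3p3:
  fixes f g h :: "3 mpoly" and n r :: nat
    and \<Delta> :: mesh_data and q :: "(real ^ 2) set \<Rightarrow> 2 mpoly"
    and a b c :: real
  assumes forms: "form (int n) f" "form (int n) g" "form (int n) h"
    and linearly_independent: "distinct [f, g, h]" "independent {f, g, h}"
    and no_basepoints:
      "\<forall>p :: complex ^ 3. p \<noteq> 0 \<longrightarrow> \<not> (eval f p = 0 \<and> eval g p = 0 \<and> eval h p = 0)"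
    and mesh: "mesh \<Delta>"
    and edge_equations: "\<forall>\<tau>\<in>interior_edges \<Delta>. on_irreducible_curve (q \<tau>) \<tau>"
    and edge_forms_in_net: "\<forall>\<tau>\<in>interior_edges \<Delta>. homogenize (q \<tau>) \<in> span {f, g, h}"
    and HP_image: "has_hilbert_poly (image_spline_module f g h r \<Delta> q) [:c, b, a:]"
  shows
    "let c2n = real (quotient_dim f g h (2 * int n));
         A = a;
         B = b * real n - 2 * ((real n ^ 2 - 1 + c2n) / real n) * a;
         C = (real n ^ 2 - 1 + 3 * c2n) * a - (real n ^ 2 - 1 + c2n) * b + real n ^ 2 * c;
         M = spline_module r \<Delta> q;
         M' = image_spline_module f g h r \<Delta> q
     in has_hilbert_poly M [:C, B, A:] \<and>
        postulation_number M \<le> int n * (postulation_number M' + 3) - 3 \<and>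
        (\<forall>d0. (\<forall>d>d0. real (hilbert_function M' d) = poly (hilbert_poly M') (of_int d)) \<longrightarrow>
              (\<forall>d>int n * (d0 + 3) - 3.
                 real (hilbert_function M d) = poly (hilbert_poly M) (of_int d)))"
  proof -
  interpret net f g h n
    by unfold_locales (use forms linearly_independent no_basepoints in auto)
  let ?G = "\<lambda>\<tau>. homogenize (q \<tau>)"
  let ?M = "spline_module r \<Delta> q" and ?M' = "image_spline_module f g h r \<Delta> q"
  define H where "H d = real (hilbert_function ?M' d)" for d
  note fin = mesh_faces(1)[OF mesh] and ne = mesh_faces(2)[OF mesh]
  have res: "real (hilbert_function ?M (int n * K + int e)) = c0 e * H K + c1 e * H (K - 1) + c2 e * H (K - 2)"
    if "e < n" for e K
    unfolding spline_module_def image_spline_module_def H_def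
  proof (rule hilbert_function_residue[OF fin _ _ that])
    fix \<tau> assume \<tau>: "\<tau> \<in> interior_edges \<Delta>"
    note l = line_of[OF edge_forms_in_net[rule_format, OF \<tau>]]
    show "form (int (r + 1)) (line_of f g h (?G \<tau>) ^ (r + 1))"
      using form_power[OF l(1), of "r + 1"] by simp
    show "?G \<tau> ^ (r + 1) = \<phi> (line_of f g h (?G \<tau>) ^ (r + 1))"
      by (simp only: \<phi>_power l(2))
  qed
  define c2n where "c2n = real (quotient_dim f g h (2 * int n))"
  define B where "B = b * real n - 2 * ((real n ^ 2 - 1 + c2n) / real n) * a"
  define C where "C = (real n ^ 2 - 1 + 3 * c2n) * a - (real n ^ 2 - 1 + c2n) * b + real n ^ 2 * c"
  let ?P = "[:c, b, a:]" and ?Q = "[:C, B, a:]"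
  have n: "real n > 0" using degree_pos by simp
  have c2n: "c2n = (real n - 1) * (real n - 2) / 2" by (simp add: c2n_def quotient_dim_2n)
  \<comment> \<open>With this value, n^2 - 1 + c_n(2n) = 3n(n - 1)/2.\<close>
  have B: "B = b * real n - 3 * (real n - 1) * a"
    using n by (simp add: B_def c2n field_simps power2_eq_square)
  \<comment> \<open>The same quadratic serves all residues \<open>e\<close>, although each has its
    own three weights.\<close>
  have id: "c0 e * poly ?P K + c1 e * poly ?P (K - 1) + c2 e * poly ?P (K - 2)
      = poly ?Q (real n * K + real e)" for e K
    unfolding B C_def c2n c0_def c1_def c2_def by (simp add: field_simps power2_eq_square)
  \<comment> \<open>Kept general in \<open>d0\<close>: it is applied with some threshold to find the
    Hilbert polynomial, with the postulation number, and for the final clause.\<close>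
  have large: "real (hilbert_function ?M d) = poly ?Q (of_int d)"
    if d0: "\<And>d. d > d0 \<Longrightarrow> H d = poly ?P (of_int d)" and d: "d > int n * (d0 + 3) - 3" for d d0
  proof -
    define K where "K = d div int n"
    define e where "e = nat (d mod int n)"
    have e: "e < n" using degree_pos by (simp add: e_def nat_less_iff)
    have de: "d = int n * K + int e" using degree_pos by (simp add: K_def e_def)
    have bound: "int n * d0 + 3 * int n - 3 < int n * K + int e"
      using d de by (simp add: algebra_simps)
    have up: "int n * K \<le> int n * (d0 + m)" if "\<not> K - m > d0" for m
      using that by (intro mult_left_mono) auto
    have "K > d0"
    proof (rule ccontr)
      assume "\<not> K > d0"
      then have "int n * K \<le> int n * d0" using up[of 0] by simp
      moreover have "int e < int n" "int n > 0" using e degree_pos by auto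
      ultimately show False using bound by linarith
    qed
    then have K: "H K = poly ?P (of_int K)" by (rule d0)
    \<comment> \<open>If \<open>K - 1 \<le> d0\<close>, the bound on \<open>d\<close> leaves only n
      = 1, where the weight \<open>c1 e\<close> is zero.\<close>
    have K1: "c1 e * H (K - 1) = c1 e * poly ?P (of_int K - 1)"
    proof (cases "K - 1 > d0")
      case True
      then show ?thesis by (simp add: d0)
    next
      case False
      then have "n = 1" using up[of 1] bound e by (simp add: algebra_simps)
      then show ?thesis using c1_vanishes e by simp
    qed
    \<comment> \<open>If \<open>K - 2 \<le> d0\<close>, the bound forces
      \<open>n \<le> e + 2\<close>, so degree e + 2n lies beyond 3n - 3 and has weight zero.\<close>
    have K2: "c2 e * H (K - 2) = c2 e * poly ?P (of_int K - 2)"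
    proof (cases "K - 2 > d0")
      case True
      then show ?thesis by (simp add: d0)
    next
      case False
      then have "n \<le> e + 2" using up[of 2] bound by (simp add: algebra_simps)
      then show ?thesis using c2_vanishes[OF e] by simp
    qed
    show ?thesis
      unfolding de res[OF e] K K1 K2 id by simp
  qed
  obtain D where "\<And>d. d \<ge> D \<Longrightarrow> H d = poly ?P (of_int d)"
    using HP_image by (auto simp: has_hilbert_poly_def eventually_at_top_linorder H_def)
  then have "real (hilbert_function ?M d) = poly ?Q (of_int d)" if "d > int n * (D + 3) - 3" for d
    using that by (intro large[of D]) auto
  then have HP: "has_hilbert_poly ?M ?Q"
    unfolding has_hilbert_poly_def eventually_at_top_dense by blast
  note post' = postulation_number(2)[OF HP_image, folded H_def]
  have zero: "0 \<in> ?M" "0 \<in> ?M'"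
    unfolding spline_module_def image_spline_module_def
    using subspace_0[OF subspace_difference_kernel] by blast+
  have nz: "hilbert_function ?M 0 \<noteq> 0" "hilbert_function ?M' 0 \<noteq> 0"
    unfolding spline_module_def image_spline_module_def
    by (rule hilbert_function_difference_kernel_0[OF fin ne])+
  have "postulation_number ?M \<le> int n * (postulation_number ?M' + 3) - 3"
  proof (rule ccontr)
    assume "\<not> ?thesis"
    then have "real (hilbert_function ?M (postulation_number ?M)) = poly ?Q (of_int (postulation_number ?M))"
      by (intro large[OF post'[OF zero(2) nz(2)]]) auto
    then show False using postulation_number(1)[OF HP zero(1) nz(1)] by contradiction
  qed
  moreover have "\<forall>d0. (\<forall>d>d0. real (hilbert_function ?M' d) = poly (hilbert_poly ?M') (of_int d)) \<longrightarrow>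
      (\<forall>d>int n * (d0 + 3) - 3. real (hilbert_function ?M d) = poly (hilbert_poly ?M) (of_int d))"
    unfolding hilbert_poly_unique[OF HP] hilbert_poly_unique[OF HP_image]
    by (intro allI impI large) (auto simp: H_def)
  ultimately show ?thesis
    using HP unfolding Let_def B_def C_def c2n_def by blast
qed

end
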